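(* Let $d\in\mathbb{N}$, $d\ge2$, $x\in\mathbb{R}^d$ and $\beta\in(0,\infty)$. There exists a constant $L_{\beta,d}>0$, depending on $\beta,d$, such that for every $L\ge L_{\beta,d}$ there exists a constant $c(L,\beta,d)>0$, depending on $L,\beta,d$, such that for every $n\in\mathbb{N}$, $n\ge1$, and every estimator $\widehat f(x)$ of $f(x)$ based on an i.i.d. sample $(S_1,U_1),\dots,(S_n,U_n)$ with density $\rho_d^{-1}\mathcal{R}[f]$, $$\sup_{f\in\mathcal{W}^\beta(L)}\mathbb{E}_{\mathcal{R}[f]}\left[\left|\widehat f(x)-f(x)\right|^2\right]\ge c(L,\beta,d)\,n^{-\frac{2\beta-d}{2\beta+d-1}},$$ where the supremum is over all probability densities $f:\mathbb{R}^d\to[0,\infty)$ belonging to $\mathcal{W}^\beta(L)$.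
   Context: $\|\cdot\|$ and $\langle\cdot,\cdot\rangle$ are the Euclidean norm and scalar product, $\mathbb{S}^{d-1}$ is the unit sphere of $\mathbb{R}^d$ with surface measure $\sigma^{d-1}$, and $\rho_d:=2\pi^{d/2}/\Gamma(d/2)$ is its total surface measure. $\lambda^d$ is Lebesgue measure on $\mathbb{R}^d$. Radon transform: for $h\in L^1(\mathbb{R}^d)$ and $(s,u)\in\mathbb{S}^{d-1}\times\mathbb{R}$, $\mathcal{R}[h](s,u):=\int_{\{v\in\mathbb{R}^d:\langle v,s\rangle=u\}}h(v)\,dv$, integration being with respect to the hypersurface ($(d-1)$-dimensional Lebesgue) measure on the hyperplane. For a probability density $f$, $\rho_d^{-1}\mathcal{R}[f]$ is a probability density on $\mathbb{S}^{d-1}\times\mathbb{R}$ with respect to $\sigma^{d-1}\otimes\lambda^1$. $\mathbb{E}_{\mathcal{R}[f]}$ denotes expectation when the observations $(S_i,U_i)$ are i.i.d. with this density. Fourier transform: $\mathcal{F}_d[h](t):=\int_{\mathbb{R}^d}e^{i\langle t,y\rangle}h(y)\,d\lambda^d(y)$ for $h\in L^1(\mathbb{R}^d)\cap L^2(\mathbb{R}^d)$ (extended to $L^2(\mathbb{R}^d)$ as usual). Sobolev ellipsoid: for $L,\beta\in(0,\infty)$, $\mathcal{W}^\beta(L):=\{f\in L^2(\mathbb{R}^d):\int_{\mathbb{R}^d}(1+\|t\|^2)^\beta|\mathcal{F}_d[f](t)|^2\,d\lambda^d(t)\le L\}$. An estimator $\widehat f(x)$ is any real-valued measurable function of the sample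 $(S_1,U_1),\dots,(S_n,U_n)$. *)

theory Defs
  imports "HOL-Analysis.Analysis"
begin

section \<open>Surface measures\<close>

definition sphere_area :: "nat \<Rightarrow> real" where
  "sphere_area d = 2 * pi powr (real d / 2) / Gamma (real d / 2)"

text \<open>The surface measure as cone measure: the area of \<open>A\<close> is \<open>d\<close> times the volume
  of the cone of all \<open>r *\<^sub>R s\<close> with \<open>s \<in> A\<close> and \<open>0 < r \<le> 1\<close>.\<close>

definition sphere_measure :: "'a::euclidean_space measure" where
  "sphere_measure = scale_measure (of_nat DIM('a))
     (distr (restrict_space lborel (cball 0 1 - {0})) (restrict_space borel (sphere 0 1)) sgn)"

definition is_orthonormal_basis_perp :: "'a::euclidean_space \<Rightarrow> 'a set \<Rightarrow> bool" where
  "is_orthonormal_basis_perp s B \<longleftrightarrow>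
     pairwise orthogonal B \<and> (\<forall>b\<in>B. norm b = 1) \<and> span B = {v. v \<bullet> s = 0}"

text \<open>Lebesgue measure on the hyperplane of all \<open>v\<close> with \<open>v \<bullet> s = u\<close>, for a unit vector \<open>s\<close>:
  product Lebesgue measure in the coordinates of an orthonormal basis of the directions
  perpendicular to \<open>s\<close>, with origin \<open>u *\<^sub>R s\<close>. The measure does not depend on the basis chosen.\<close>

definition hyperplane_measure :: "'a::euclidean_space \<Rightarrow> real \<Rightarrow> 'a measure" where
  "hyperplane_measure s u =
     (let B = (SOME B. is_orthonormal_basis_perp s B) in
        distr (Pi\<^sub>M B (\<lambda>_. lborel)) borel (\<lambda>y. u *\<^sub>R s + (\<Sum>b\<in>B. y b *\<^sub>R b)))"

lemma ex_orthonormal_basis_perp: "\<exists>B. is_orthonormal_basis_perp s B"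
proof -
  have "subspace {v. v \<bullet> s = 0}"
    by (simp add: subspace_def inner_add_left)
  then show ?thesis
    unfolding is_orthonormal_basis_perp_def
    by (metis (no_types, lifting) orthonormal_basis_subspace)
qed

lemma space_sphere_measure: "space (sphere_measure :: 'a::euclidean_space measure) = sphere 0 1"
  by (simp add: sphere_measure_def space_scale_measure space_restrict_space)

lemma sphere_measure_total:
  "emeasure (sphere_measure :: 'a::euclidean_space measure) (sphere 0 1)
     = ennreal (sphere_area DIM('a))"
proof -
  let ?C = "cball (0::'a) 1 - {0}"
  let ?R = "restrict_space lborel ?C"
  let ?S = "restrict_space borel (sphere (0::'a) 1)"
  have sgn_C: "sgn v \<in> sphere 0 1" if "v \<in> ?C" for v :: 'a
    using that by (simp add: norm_sgn)
  have "(sgn :: 'a \<Rightarrow> 'a) \<in> borel_measurable lborel"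
    unfolding sgn_div_norm by measurable
  then have meas: "sgn \<in> measurable ?R ?S"
    using sgn_C by (intro measurable_restrict_space2 measurable_restrict_space1)
      (auto simp: space_restrict_space)
  have "emeasure (distr ?R ?S sgn) (sphere 0 1) = emeasure ?R (sgn -` sphere 0 1 \<inter> space ?R)"
    by (rule emeasure_distr[OF meas]) (auto simp: sets_restrict_space)
  also have "sgn -` sphere 0 1 \<inter> space ?R = ?C"
    using sgn_C by (auto simp: space_restrict_space)
  also have "emeasure ?R ?C = emeasure lborel ?C"
    by (rule emeasure_restrict_space) auto
  also have "\<dots> = emeasure lborel (cball (0::'a) 1)"
    by (intro emeasure_Diff_null_set) (auto simp: null_sets_def)
  also have "\<dots> = ennreal (unit_ball_vol DIM('a))"
    by (subst emeasure_cball) auto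
  finally have "emeasure (sphere_measure :: 'a measure) (sphere 0 1)
      = ennreal (real DIM('a) * unit_ball_vol DIM('a))"
    by (simp add: sphere_measure_def ennreal_mult' ennreal_of_nat_eq_real_of_nat)
  also have "real DIM('a) * unit_ball_vol DIM('a) = sphere_area DIM('a)"
  proof -
    have "Gamma (real DIM('a) / 2 + 1) = real DIM('a) / 2 * Gamma (real DIM('a) / 2)"
      by (rule Gamma_plus1) (use DIM_positive[where 'a = 'a] in \<open>force dest: nonpos_Ints_nonpos\<close>)
    moreover have "Gamma (real DIM('a) / 2) \<noteq> 0"
      using Gamma_real_pos[of "real DIM('a) / 2"] DIM_positive[where 'a = 'a] by linarith
    ultimately show ?thesis
      unfolding unit_ball_vol_def sphere_area_def by (simp only:) (simp add: divide_simps)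
  qed
  finally show ?thesis .
qed


section \<open>Radon transform and the observation model\<close>

definition radon :: "('a::euclidean_space \<Rightarrow> real) \<Rightarrow> 'a \<Rightarrow> real \<Rightarrow> real" where
  "radon h s u = (\<integral>v. h v \<partial>hyperplane_measure s u)"

definition obs_measure :: "('a::euclidean_space \<times> real) measure" where
  "obs_measure = sphere_measure \<Otimes>\<^sub>M lborel"

definition radon_law :: "('a::euclidean_space \<Rightarrow> real) \<Rightarrow> ('a \<times> real) measure" where
  "radon_law f = density obs_measure (\<lambda>(s, u). ennreal (radon f s u / sphere_area DIM('a)))"

definition sample_law :: "nat \<Rightarrow> ('a::euclidean_space \<Rightarrow> real) \<Rightarrow> (nat \<Rightarrow> 'a \<times> real) measure" where
  "sample_law n f = Pi\<^sub>M {..<n} (\<lambda>_. radon_law f)"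

definition estimators :: "nat \<Rightarrow> ((nat \<Rightarrow> 'a::euclidean_space \<times> real) \<Rightarrow> real) set" where
  "estimators n = borel_measurable (Pi\<^sub>M {..<n} (\<lambda>_. obs_measure))"

definition prob_densities :: "('a::euclidean_space \<Rightarrow> real) set" where
  "prob_densities =
     {f \<in> borel_measurable borel. (\<forall>v. 0 \<le> f v) \<and> (\<integral>\<^sup>+v. ennreal (f v) \<partial>lborel) = 1}"


section \<open>Fourier transform and Sobolev ellipsoids\<close>

definition L2_functions :: "('a::euclidean_space \<Rightarrow> complex) set" where
  "L2_functions =
     {h \<in> borel_measurable borel. (\<integral>\<^sup>+y. ennreal ((cmod (h y))\<^sup>2) \<partial>lborel) < \<infinity>}"

definition fourier :: "('a::euclidean_space \<Rightarrow> complex) \<Rightarrow> 'a \<Rightarrow> complex" where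
  "fourier h t = (\<integral>y. exp (\<i> * complex_of_real (t \<bullet> y)) * h y \<partial>lborel)"

text \<open>\<open>g\<close> is a version of the Fourier transform on \<open>L\<^sup>2\<close> of \<open>f\<close>, which is the \<open>L\<^sup>2\<close>-continuous
  extension of \<^const>\<open>fourier\<close> from \<open>L\<^sup>1 \<inter> L\<^sup>2\<close>. It determines \<open>g\<close> up to null sets.\<close>

definition is_fourier_L2 ::
    "('a::euclidean_space \<Rightarrow> complex) \<Rightarrow> ('a \<Rightarrow> complex) \<Rightarrow> bool" where
  "is_fourier_L2 f g \<longleftrightarrow> f \<in> L2_functions \<and> g \<in> L2_functions \<and>
     (\<exists>h :: nat \<Rightarrow> 'a \<Rightarrow> complex.
        (\<forall>k. h k \<in> L2_functions \<and> integrable lborel (h k)) \<and>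
        (\<lambda>k. \<integral>\<^sup>+y. ennreal ((cmod (h k y - f y))\<^sup>2) \<partial>lborel) \<longlonglongrightarrow> 0 \<and>
        (\<lambda>k. \<integral>\<^sup>+t. ennreal ((cmod (fourier (h k) t - g t))\<^sup>2) \<partial>lborel) \<longlonglongrightarrow> 0)"

definition sobolev_ellipsoid :: "real \<Rightarrow> real \<Rightarrow> ('a::euclidean_space \<Rightarrow> real) set" where
  "sobolev_ellipsoid \<beta> L = {f. \<exists>g. is_fourier_L2 (\<lambda>v. complex_of_real (f v)) g \<and>
     (\<integral>\<^sup>+t. ennreal ((1 + (norm t)\<^sup>2) powr \<beta> * (cmod (g t))\<^sup>2) \<partial>lborel) \<le> ennreal L}"

text \<open>Elements of \<open>L\<^sup>2\<close> are only defined up to null sets, so for the value \<open>f x\<close> at a point to be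
  meaningful the continuous representative is taken; it exists for every class in the ellipsoid
  when \<open>\<beta> > d / 2\<close>. Without this a change of \<open>f\<close> at the single point \<open>x\<close>, which
  leaves the law of the observations unchanged, would make every worst-case risk infinite.\<close>

definition sobolev_densities :: "real \<Rightarrow> real \<Rightarrow> ('a::euclidean_space \<Rightarrow> real) set" where
  "sobolev_densities \<beta> L =
     {f \<in> prob_densities \<inter> sobolev_ellipsoid \<beta> L. continuous_on UNIV f}"

end

theory Submission
  imports Defs "HOL-Probability.Probability"
begin

text \<open>Two-point method with \<open>f\<^sub>0 = N(x, I)\<close> and \<open>f\<^sub>1 = (1 - \<epsilon>) N(x, I) + \<epsilon> N(x, \<sigma>\<^sup>2 I)\<close>, where
  \<open>\<sigma> = n\<close> to the power \<open>- 1 / (2 \<beta> + d - 1)\<close>, divided by 2, and \<open>\<epsilon>\<^sup>2 = \<sigma>\<close> to the power \<open>2 \<beta> + d\<close>.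
  Perturbing by a mixture rather than by an oscillating bump keeps \<open>f\<^sub>1\<close> nonnegative for every
  \<open>\<beta> > 0\<close>, also when \<open>f\<^sub>1 x\<close> is unbounded in \<open>n\<close>. The choice of \<open>\<epsilon>\<close> bounds the Sobolev integral
  of \<open>f\<^sub>1\<close> uniformly in \<open>n\<close>. The Radon transform of an isotropic Gaussian is a one-dimensional
  normal density in \<open>u\<close>, so the \<open>\<chi>\<^sup>2\<close>-divergence of the laws of one observation is at most
  \<open>\<epsilon>\<^sup>2 / \<sigma> \<le> 1 / n\<close>, while the values at \<open>x\<close> differ by a multiple of \<open>\<epsilon>\<close> divided by \<open>\<sigma>\<close> to the power \<open>d\<close>.\<close>

section \<open>The two-point bound for product measures\<close>

text \<open>Both sides give a rectangle the product of the one-coordinate masses: the density and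
  the indicator factor over the coordinates, and Tonelli separates the integrals. Uniqueness of
  product measures then applies, since probability measures are sigma-finite.\<close>

lemma PiM_density:
  assumes I: "finite I" and M: "prob_space M" and f[measurable]: "f \<in> borel_measurable M"
    and D: "prob_space (density M f)"
  shows "PiM I (\<lambda>_. density M f) = density (PiM I (\<lambda>_. M)) (\<lambda>x. \<Prod>i\<in>I. f (x i))"
proof -
  interpret M: prob_space M by fact
  interpret D: prob_space "density M f" by fact
  interpret PM: product_sigma_finite "\<lambda>_. M" by standard
  interpret PD: product_sigma_finite "\<lambda>_. density M f" by standard
  have [measurable]: "(\<lambda>x. \<Prod>i\<in>I. f (x i)) \<in> borel_measurable (PiM I (\<lambda>_. M))"
    by (intro borel_measurable_prod_ennreal) measurable
  have "density (PiM I (\<lambda>_. M)) (\<lambda>x. \<Prod>i\<in>I. f (x i)) = PiM I (\<lambda>_. density M f)"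
  proof (rule PD.PiM_eqI[OF I])
    show "sets (density (PiM I (\<lambda>_. M)) (\<lambda>x. \<Prod>i\<in>I. f (x i))) = sets (PiM I (\<lambda>_. density M f))"
      by (simp cong: sets_PiM_cong)
    fix A assume "\<And>i. i \<in> I \<Longrightarrow> A i \<in> sets (density M f)"
    then have A: "\<And>i. i \<in> I \<Longrightarrow> A i \<in> sets M" by simp
    have ind: "(\<Prod>i\<in>I. f (x i)) * indicator (Pi\<^sub>E I A) x = (\<Prod>i\<in>I. f (x i) * indicator (A i) (x i))"
      if "x \<in> space (PiM I (\<lambda>_. M))" for x
    proof (cases "x \<in> Pi\<^sub>E I A")
      case True
      then show ?thesis by (auto simp: PiE_iff intro!: prod.cong)
    next
      case False
      with that obtain i where "i \<in> I" "x i \<notin> A i" by (auto simp: space_PiM PiE_iff)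
      then have "(\<Prod>i\<in>I. f (x i) * indicator (A i) (x i)) = 0"
        using I by (intro prod_zero bexI[of _ i]) auto
      with False show ?thesis by simp
    qed
    have "emeasure (density (PiM I (\<lambda>_. M)) (\<lambda>x. \<Prod>i\<in>I. f (x i))) (Pi\<^sub>E I A)
        = (\<integral>\<^sup>+x. (\<Prod>i\<in>I. f (x i)) * indicator (Pi\<^sub>E I A) x \<partial>PiM I (\<lambda>_. M))"
      using A I by (intro emeasure_density) (auto intro!: sets_PiM_I_finite)
    also have "\<dots> = (\<integral>\<^sup>+x. (\<Prod>i\<in>I. f (x i) * indicator (A i) (x i)) \<partial>PiM I (\<lambda>_. M))"
      by (rule nn_integral_cong) (rule ind)
    also have "\<dots> = (\<Prod>i\<in>I. \<integral>\<^sup>+x. f x * indicator (A i) x \<partial>M)"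
      using A by (intro PM.product_nn_integral_prod[OF I] borel_measurable_times_ennreal f borel_measurable_indicator) auto
    also have "\<dots> = (\<Prod>i\<in>I. emeasure (density M f) (A i))"
      using A by (intro prod.cong) (auto simp: emeasure_density)
    finally show "emeasure (density (PiM I (\<lambda>_. M)) (\<lambda>x. \<Prod>i\<in>I. f (x i))) (Pi\<^sub>E I A)
        = (\<Prod>i\<in>I. emeasure (density M f) (A i))" .
  qed
  then show ?thesis by simp
qed

text \<open>Here \<open>W\<close> is the likelihood ratio of a second law against \<open>P\<close>:
  \<open>R1\<close> bounds the risk under that law for the target \<open>a\<close>, and
  \<open>R0\<close> the risk under \<open>P\<close> for \<open>b\<close>. The second moment of
  \<open>W\<close> is 1 plus the chi-square divergence; bounding it prevents one estimator from
  being close to both targets.\<close>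

lemma two_point_bound:
  fixes W e :: "'b \<Rightarrow> real"
  assumes P: "prob_space P" and [measurable]: "W \<in> borel_measurable P" "e \<in> borel_measurable P"
    and W0: "\<And>\<omega>. 0 \<le> W \<omega>"
    and W1: "(\<integral>\<^sup>+\<omega>. ennreal (W \<omega>) \<partial>P) = 1" and W2: "(\<integral>\<^sup>+\<omega>. ennreal ((W \<omega>)\<^sup>2) \<partial>P) \<le> 3"
    and R1: "(\<integral>\<^sup>+\<omega>. ennreal (W \<omega>) * ennreal (\<bar>e \<omega> - a\<bar>\<^sup>2) \<partial>P) \<le> R"
    and R0: "(\<integral>\<^sup>+\<omega>. ennreal (\<bar>e \<omega> - b\<bar>\<^sup>2) \<partial>P) \<le> R"
  shows "ennreal ((a - b)\<^sup>2 / 8) \<le> R"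
proof (cases "R = \<top>")
  case False
  then obtain r where r: "R = ennreal r" "0 \<le> r" by (cases R) auto
  let ?D = "(a - b)\<^sup>2"
  have pw: "W \<omega> * ?D \<le> ?D / 4 * W \<omega> + W \<omega> * \<bar>e \<omega> - a\<bar>\<^sup>2 + ?D / 12 * (W \<omega>)\<^sup>2 + 3 * \<bar>e \<omega> - b\<bar>\<^sup>2" for \<omega>
  proof -
    let ?p = "a - e \<omega>" and ?q = "e \<omega> - b"
    \<comment> \<open>AM-GM for \<open>(a - b)\<^sup>2 W = (a - b) W (a - e) + (a - b) W (e - b)\<close>; the weights are chosen so that both
      \<open>W\<close>-terms integrate to at most \<open>(a - b)\<^sup>2 / 4\<close>.\<close>
    have "0 \<le> W \<omega> * ((a - b) / 2 - ?p)\<^sup>2" using W0 by simp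
    moreover have "0 \<le> ((a - b) * W \<omega> / 6 - ?q)\<^sup>2" by simp
    ultimately show ?thesis
      by (simp add: power2_eq_square algebra_simps)
  qed
  have "ennreal ?D = ennreal ?D * (\<integral>\<^sup>+\<omega>. ennreal (W \<omega>) \<partial>P)" using W1 by simp
  also have "\<dots> = (\<integral>\<^sup>+\<omega>. ennreal (W \<omega> * ?D) \<partial>P)"
    by (subst nn_integral_cmult[symmetric]) (auto simp: ennreal_mult'[symmetric] mult.commute W0)
  also have "\<dots> \<le> (\<integral>\<^sup>+\<omega>. ennreal (?D / 4) * ennreal (W \<omega>) + ennreal (W \<omega>) * ennreal (\<bar>e \<omega> - a\<bar>\<^sup>2)
       + ennreal (?D / 12) * ennreal ((W \<omega>)\<^sup>2) + ennreal 3 * ennreal (\<bar>e \<omega> - b\<bar>\<^sup>2) \<partial>P)"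
  proof (rule nn_integral_mono)
    fix \<omega>
    show "ennreal (W \<omega> * ?D) \<le> ennreal (?D / 4) * ennreal (W \<omega>) + ennreal (W \<omega>) * ennreal (\<bar>e \<omega> - a\<bar>\<^sup>2)
       + ennreal (?D / 12) * ennreal ((W \<omega>)\<^sup>2) + ennreal 3 * ennreal (\<bar>e \<omega> - b\<bar>\<^sup>2)"
      using ennreal_leI[OF pw[of \<omega>]] W0[of \<omega>]
      by (simp add: ennreal_plus[symmetric] ennreal_mult[symmetric] del: ennreal_plus power2_abs flip: ennreal_numeral)
  qed
  also have "\<dots> = ennreal (?D / 4) * (\<integral>\<^sup>+\<omega>. ennreal (W \<omega>) \<partial>P)
       + (\<integral>\<^sup>+\<omega>. ennreal (W \<omega>) * ennreal (\<bar>e \<omega> - a\<bar>\<^sup>2) \<partial>P)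
       + ennreal (?D / 12) * (\<integral>\<^sup>+\<omega>. ennreal ((W \<omega>)\<^sup>2) \<partial>P) + ennreal 3 * (\<integral>\<^sup>+\<omega>. ennreal (\<bar>e \<omega> - b\<bar>\<^sup>2) \<partial>P)"
    by (simp add: nn_integral_add nn_integral_cmult)
  also have "\<dots> \<le> ennreal (?D / 4) * 1 + R + ennreal (?D / 12) * 3 + ennreal 3 * R"
    unfolding W1 by (intro add_mono mult_left_mono R1 R0 W2) auto
  also have "\<dots> = ennreal (?D / 4 + r + ?D / 12 * 3 + 3 * r)"
    using r(2) unfolding r(1)
    by (simp add: ennreal_plus[symmetric] ennreal_mult[symmetric] del: ennreal_plus flip: ennreal_numeral)
  \<comment> \<open>With \<open>R\<close> finite this is an inequality of reals, and it cancels to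
    \<open>?D / 2 \<le> 4 * r\<close>.\<close>
  finally have "?D \<le> ?D / 4 + r + ?D / 12 * 3 + 3 * r"
    using r(2) by (subst (asm) ennreal_le_iff) auto
  then show ?thesis unfolding r(1) by (intro ennreal_leI) simp
qed simp

text \<open>The likelihood ratio of the sample is the product of the \<open>w (\<omega> i)\<close>,
  so by independence its second moment is at most
  \<open>(1 + 1 / n) ^ n \<le> exp 1 \<le> 3\<close>. This is the source of the 3 in
  \<open>two_point_bound\<close>.\<close>

lemma product_two_point_bound:
  fixes w :: "'b \<Rightarrow> real"
  assumes M: "prob_space M" and w[measurable]: "w \<in> borel_measurable M" and w0: "\<And>\<omega>. 0 \<le> w \<omega>"
    and w1: "(\<integral>\<^sup>+\<omega>. ennreal (w \<omega>) \<partial>M) = 1"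
    and w2: "(\<integral>\<^sup>+\<omega>. ennreal ((w \<omega>)\<^sup>2) \<partial>M) \<le> ennreal (1 + 1 / real n)"
    and n: "n \<ge> 1" and e[measurable]: "e \<in> borel_measurable (PiM {..<n} (\<lambda>_. M))"
    and R1: "(\<integral>\<^sup>+\<omega>. ennreal (\<bar>e \<omega> - a\<bar>\<^sup>2) \<partial>PiM {..<n} (\<lambda>_. density M w)) \<le> R"
    and R0: "(\<integral>\<^sup>+\<omega>. ennreal (\<bar>e \<omega> - b\<bar>\<^sup>2) \<partial>PiM {..<n} (\<lambda>_. M)) \<le> R"
  shows "ennreal ((a - b)\<^sup>2 / 8) \<le> R"
proof -
  interpret M: prob_space M by fact
  interpret PM: product_prob_space "\<lambda>_. M" "{..<n}" by standard
  let ?P = "PiM {..<n} (\<lambda>_. M)" and ?W = "\<lambda>\<omega>. \<Prod>i<n. w (\<omega> i)"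
  have D: "prob_space (density M w)"
    by (rule prob_spaceI) (simp add: emeasure_density w1 cong: nn_integral_cong)
  have W[measurable]: "?W \<in> borel_measurable ?P"
    by (intro borel_measurable_prod) measurable
  have prod: "(\<integral>\<^sup>+\<omega>. ennreal (\<Prod>i<n. g (\<omega> i)) \<partial>?P) = (\<integral>\<^sup>+\<omega>. ennreal (g \<omega>) \<partial>M) ^ n"
    if [measurable]: "g \<in> borel_measurable M" and "\<And>\<omega>. 0 \<le> g \<omega>" for g :: "'b \<Rightarrow> real"
    using PM.product_nn_integral_prod[of "{..<n}" "\<lambda>_ \<omega>. ennreal (g \<omega>)"] that(2)
    by (simp add: prod_ennreal)
  show ?thesis
  proof (rule two_point_bound[where W = ?W])
    show "prob_space ?P" by (rule prob_space_PiM) (rule M)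
    show "(\<integral>\<^sup>+\<omega>. ennreal (?W \<omega>) \<partial>?P) = 1" by (subst prod) (auto simp: w0 w1)
    have "(\<integral>\<^sup>+\<omega>. ennreal ((?W \<omega>)\<^sup>2) \<partial>?P) = (\<integral>\<^sup>+\<omega>. ennreal ((w \<omega>)\<^sup>2) \<partial>M) ^ n"
      by (subst prod[symmetric]) (auto simp: prod_power_distrib)
    also have "\<dots> \<le> ennreal (1 + 1 / real n) ^ n" by (rule power_mono[OF w2]) simp
    also have "\<dots> = ennreal ((1 + 1 / real n) ^ n)" by (rule ennreal_power) simp
    also have "(1 + 1 / real n) ^ n \<le> exp (1 / real n) ^ n"
      by (intro power_mono exp_ge_add_one_self) auto
    also have "exp (1 / real n) ^ n = exp (1::real)"
      using n by (simp add: exp_of_nat_mult[symmetric])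
    also have "ennreal (exp 1) \<le> ennreal 3" by (intro ennreal_leI exp_le)
    finally show "(\<integral>\<^sup>+\<omega>. ennreal ((?W \<omega>)\<^sup>2) \<partial>?P) \<le> 3" by (simp add: ennreal_leI)
    show "(\<integral>\<^sup>+\<omega>. ennreal (?W \<omega>) * ennreal (\<bar>e \<omega> - a\<bar>\<^sup>2) \<partial>?P) \<le> R"
      using R1 unfolding PiM_density[OF finite_lessThan M measurable_compose[OF w measurable_ennreal] D]
      by (subst (asm) nn_integral_density) (auto simp: prod_ennreal w0)
  qed (use R0 w0 in \<open>auto intro: prod_nonneg\<close>)
qed

section \<open>Isotropic Gaussians: Radon and Fourier transform\<close>

text \<open>The index set is arbitrary because it serves both for \<open>Basis\<close> and for an
  orthonormal basis of a hyperplane, which has one element fewer.\<close>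

lemma prod_normal_density:
  assumes "finite B"
  shows "(\<Prod>b\<in>B. normal_density (m b) \<sigma> (y b))
    = (1 / sqrt (2 * pi * \<sigma>\<^sup>2)) ^ card B * exp (- (\<Sum>b\<in>B. (y b - m b)\<^sup>2) / (2 * \<sigma>\<^sup>2))"
proof -
  have "(\<Prod>b\<in>B. exp (- (y b - m b)\<^sup>2 / (2 * \<sigma>\<^sup>2))) = exp (\<Sum>b\<in>B. - (y b - m b)\<^sup>2 / (2 * \<sigma>\<^sup>2))"
    by (rule exp_sum[OF assms(1), symmetric])
  then show ?thesis
    unfolding normal_density_def prod.distrib
    by (simp add: sum_divide_distrib[symmetric] sum_negf)
qed

text \<open>The density of N(x, \<sigma>^2 I). The product form gives the total mass and the Fourier
  transform by integrating coordinatewise; the rotation-invariant form in \<open>gauss_eq\<close>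
  gives the Radon transform.\<close>

definition gauss :: "'a::euclidean_space \<Rightarrow> real \<Rightarrow> 'a \<Rightarrow> real" where
  "gauss x \<sigma> v = (\<Prod>b\<in>Basis. normal_density (x \<bullet> b) \<sigma> (v \<bullet> b))"

lemma gauss_eq:
  fixes x :: "'a::euclidean_space"
  assumes "0 < \<sigma>"
  shows "gauss x \<sigma> v = (1 / sqrt (2 * pi * \<sigma>\<^sup>2)) ^ DIM('a) * exp (- (norm (v - x))\<^sup>2 / (2 * \<sigma>\<^sup>2))"
proof -
  have "(norm (v - x))\<^sup>2 = (\<Sum>b\<in>Basis. (v \<bullet> b - x \<bullet> b)\<^sup>2)"
    unfolding power2_norm_eq_inner euclidean_inner[of "v - x" "v - x"]
    by (simp add: inner_diff_left power2_eq_square)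
  then show ?thesis unfolding gauss_def prod_normal_density[OF finite_Basis] by simp
qed

lemma gauss_nonneg: "0 \<le> gauss x \<sigma> v"
  unfolding gauss_def by (intro prod_nonneg) simp

lemma continuous_gauss: "continuous_on UNIV (gauss x \<sigma>)"
  \<comment> \<open>At \<open>\<sigma> = 0\<close> division by zero yields 0, so the function is
    constant.\<close>
  unfolding gauss_def[abs_def] normal_density_def by (cases "\<sigma> = 0") (auto intro!: continuous_intros)

lemma borel_measurable_gauss[measurable]: "gauss x \<sigma> \<in> borel_measurable borel"
  by (intro borel_measurable_continuous_onI continuous_gauss)

lemma nn_integral_normal_density: "0 < \<sigma> \<Longrightarrow> (\<integral>\<^sup>+u. ennreal (normal_density m \<sigma> u) \<partial>lborel) = 1"
  by (simp add: nn_integral_eq_integral)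

lemma nn_integral_gauss: "0 < \<sigma> \<Longrightarrow> (\<integral>\<^sup>+v. ennreal (gauss x \<sigma> v) \<partial>lborel) = 1"
  unfolding gauss_def
  by (simp add: prod_ennreal[symmetric] nn_integral_lborel_prod[of "\<lambda>b u. ennreal (normal_density (x \<bullet> b) \<sigma> u)"]
      nn_integral_normal_density)

lemma integrable_gauss: "0 < \<sigma> \<Longrightarrow> integrable lborel (gauss x \<sigma>)"
  by (rule integrableI_nonneg) (auto simp: gauss_nonneg nn_integral_gauss)

section \<open>Gaussians on hyperplanes\<close>

text \<open>Adding \<open>s\<close> to \<open>B\<close> gives an orthonormal basis of the whole
  space, since removing from \<open>v\<close> its component along \<open>s\<close> leaves a vector
  in \<open>span B\<close>. The cardinality follows by counting dimensions, the norm identity by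
  Pythagoras.\<close>

lemma orthonormal_basis_perp_coordinates:
  fixes s :: "'a::euclidean_space"
  assumes B: "is_orthonormal_basis_perp s B" and s: "norm s = 1"
  shows "finite B" "card B + 1 = DIM('a)"
    and "\<And>y x. (norm (u *\<^sub>R s + (\<Sum>b\<in>B. y b *\<^sub>R b) - x))\<^sup>2 = (u - x \<bullet> s)\<^sup>2 + (\<Sum>b\<in>B. (y b - x \<bullet> b)\<^sup>2)"
proof -
  from B have po: "pairwise orthogonal B" and n1: "\<And>b. b \<in> B \<Longrightarrow> norm b = 1"
    and sp: "span B = {v. v \<bullet> s = 0}"
    by (auto simp: is_orthonormal_basis_perp_def)
  have bs: "b \<bullet> s = 0" if "b \<in> B" for b using that sp span_superset[of B] by auto
  have ss: "s \<bullet> s = 1" using s by (simp add: dot_square_norm)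
  have sB: "s \<notin> B" using bs ss by force
  let ?S = "insert s B"
  have po': "pairwise orthogonal ?S"
    using po bs by (auto simp: pairwise_insert orthogonal_def inner_commute)
  have n1': "norm b = 1" if "b \<in> ?S" for b using that n1 s by auto
  have ind: "independent ?S"
    using pairwise_orthogonal_independent[OF po'] n1' by force
  have span: "span ?S = UNIV"
  proof -
    have "v \<in> span ?S" for v
    proof -
      have "v - (v \<bullet> s) *\<^sub>R s \<in> span B" unfolding sp by (simp add: inner_diff_left ss)
      then show ?thesis unfolding span_insert by auto
    qed
    then show ?thesis by auto
  qed
  have fin: "finite ?S" using independent_imp_finite[OF ind] .
  then show finB: "finite B" by simp
  have "card ?S = DIM('a)"
    using dim_span[of ?S] dim_eq_card_independent[OF ind] unfolding span by simp
  then show "card B + 1 = DIM('a)" using finB sB by simp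
  fix y x
  have x: "x = (\<Sum>b\<in>?S. (x \<bullet> b) *\<^sub>R b)"
    by (subst orthonormal_basis_expand[OF po' n1' _ fin, of x, symmetric]) (auto simp: span)
  \<comment> \<open>These are the coordinates, in the enlarged basis, of the hyperplane point
    relative to \<open>x\<close>.\<close>
  define c where "c b = (if b = s then u - x \<bullet> s else y b - x \<bullet> b)" for b
  have "u *\<^sub>R s + (\<Sum>b\<in>B. y b *\<^sub>R b) - x = (\<Sum>b\<in>?S. c b *\<^sub>R b)"
  proof -
    have "(\<Sum>b\<in>B. y b *\<^sub>R b) = (\<Sum>b\<in>B. (if b = s then u else y b) *\<^sub>R b)"
      using sB by (intro sum.cong) auto
    then have "u *\<^sub>R s + (\<Sum>b\<in>B. y b *\<^sub>R b) - x
        = (\<Sum>b\<in>?S. (if b = s then u else y b) *\<^sub>R b) - (\<Sum>b\<in>?S. (x \<bullet> b) *\<^sub>R b)"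
      using sB finB x by simp
    also have "\<dots> = (\<Sum>b\<in>?S. c b *\<^sub>R b)"
      by (subst sum_subtractf[symmetric]) (auto simp: c_def algebra_simps intro!: sum.cong)
    finally show ?thesis .
  qed
  also have "(norm (\<Sum>b\<in>?S. c b *\<^sub>R b))\<^sup>2 = (\<Sum>b\<in>?S. (norm (c b *\<^sub>R b))\<^sup>2)"
    by (rule norm_sum_Pythagorean[OF fin])
      (use po' in \<open>auto simp: pairwise_def orthogonal_def\<close>)
  also have "\<dots> = (\<Sum>b\<in>?S. (c b)\<^sup>2)" using n1' by (intro sum.cong) auto
  also have "\<dots> = (u - x \<bullet> s)\<^sup>2 + (\<Sum>b\<in>B. (y b - x \<bullet> b)\<^sup>2)"
    using sB finB by (auto simp: c_def intro!: sum.cong)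
  finally show "(norm (u *\<^sub>R s + (\<Sum>b\<in>B. y b *\<^sub>R b) - x))\<^sup>2 = (u - x \<bullet> s)\<^sup>2 + (\<Sum>b\<in>B. (y b - x \<bullet> b)\<^sup>2)" .
qed

text \<open>By Pythagoras the Gaussian splits into a normal density in \<open>u\<close> and a
  product of normal densities along the hyperplane, and the latter integrates to 1. Integrability is
  part of the claim because the mixture needs linearity of the integral.\<close>

lemma has_bochner_integral_hyperplane_gauss:
  fixes x s :: "'a::euclidean_space"
  assumes s: "norm s = 1" and \<sigma>: "0 < \<sigma>"
  shows "has_bochner_integral (hyperplane_measure s u) (gauss x \<sigma>) (normal_density (x \<bullet> s) \<sigma> u)"
proof -
  \<comment> \<open>This is the basis chosen inside \<open>hyperplane_measure\<close>; the
    computation uses only that it is orthonormal and spans the directions perpendicular to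
    \<open>s\<close>.\<close>
  define B where "B = (SOME B. is_orthonormal_basis_perp s B)"
  have B: "is_orthonormal_basis_perp s B"
    unfolding B_def by (rule someI_ex[OF ex_orthonormal_basis_perp])
  note O = orthonormal_basis_perp_coordinates[OF B s]
  interpret product_sigma_finite "\<lambda>_::'a. lborel::real measure" by standard
  have h: "hyperplane_measure s u = distr (Pi\<^sub>M B (\<lambda>_. lborel)) borel (\<lambda>y. u *\<^sub>R s + (\<Sum>b\<in>B. y b *\<^sub>R b))"
    unfolding hyperplane_measure_def B_def Let_def by (rule refl)
  have m[measurable]: "(\<lambda>y. u *\<^sub>R s + (\<Sum>b\<in>B. y b *\<^sub>R b)) \<in> measurable (Pi\<^sub>M B (\<lambda>_. lborel)) borel"
    by (intro borel_measurable_add borel_measurable_sum borel_measurable_scaleR measurable_const) auto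
  have g: "gauss x \<sigma> (u *\<^sub>R s + (\<Sum>b\<in>B. y b *\<^sub>R b))
      = normal_density (x \<bullet> s) \<sigma> u * (\<Prod>b\<in>B. normal_density (x \<bullet> b) \<sigma> (y b))" for y
  proof -
    let ?p = "(u - x \<bullet> s)\<^sup>2" and ?q = "\<Sum>b\<in>B. (y b - x \<bullet> b)\<^sup>2" and ?c = "1 / sqrt (2 * pi * \<sigma>\<^sup>2)"
    have "gauss x \<sigma> (u *\<^sub>R s + (\<Sum>b\<in>B. y b *\<^sub>R b)) = ?c ^ (card B + 1) * exp (- (?p + ?q) / (2 * \<sigma>\<^sup>2))"
      by (simp only: gauss_eq[OF \<sigma>] O(2,3))
    also have "- (?p + ?q) / (2 * \<sigma>\<^sup>2) = - ?p / (2 * \<sigma>\<^sup>2) + - ?q / (2 * \<sigma>\<^sup>2)"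
      by (simp only: minus_add_distrib add_divide_distrib)
    also have "?c ^ (card B + 1) * exp (- ?p / (2 * \<sigma>\<^sup>2) + - ?q / (2 * \<sigma>\<^sup>2))
        = (?c * exp (- ?p / (2 * \<sigma>\<^sup>2))) * (?c ^ card B * exp (- ?q / (2 * \<sigma>\<^sup>2)))"
      by (simp only: exp_add power_add power_one_right mult_ac)
    finally show ?thesis
      by (simp only: normal_density_def[of "x \<bullet> s"] prod_normal_density[OF O(1)])
  qed
  have "has_bochner_integral (Pi\<^sub>M B (\<lambda>_. lborel)) (\<lambda>y. \<Prod>b\<in>B. normal_density (x \<bullet> b) \<sigma> (y b)) 1"
    using \<sigma> unfolding has_bochner_integral_iff
    by (intro conjI product_integrable_prod[OF O(1)] product_integral_prod[OF O(1), THEN trans])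
      (auto intro: prod.neutral)
  then have "has_bochner_integral (Pi\<^sub>M B (\<lambda>_. lborel)) (\<lambda>y. gauss x \<sigma> (u *\<^sub>R s + (\<Sum>b\<in>B. y b *\<^sub>R b)))
      (normal_density (x \<bullet> s) \<sigma> u * 1)"
    unfolding g by (intro has_bochner_integral_mult_right)
  then have "has_bochner_integral (Pi\<^sub>M B (\<lambda>_. lborel)) (\<lambda>y. gauss x \<sigma> (u *\<^sub>R s + (\<Sum>b\<in>B. y b *\<^sub>R b)))
      (normal_density (x \<bullet> s) \<sigma> u)"
    by simp
  then show ?thesis unfolding h by (rule has_bochner_integral_distr[OF borel_measurable_gauss m])
qed

section \<open>Fourier transforms of Gaussians\<close>

text \<open>The substitution \<open>m + \<sigma> * u\<close> reduces this to the characteristic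
  function of the standard normal distribution, the shift by \<open>m\<close> becoming a
  phase.\<close>

lemma has_bochner_integral_fourier_normal:
  assumes \<sigma>: "0 < \<sigma>"
  shows "has_bochner_integral lborel (\<lambda>u. exp (\<i> * of_real (t * u)) * of_real (normal_density m \<sigma> u))
    (exp (\<i> * of_real (t * m)) * of_real (exp (- (\<sigma> * t)\<^sup>2 / 2)) :: complex)"
proof -
  let ?F = "\<lambda>u. exp (\<i> * of_real (t * u)) * of_real (normal_density m \<sigma> u) :: complex"
  have int: "integrable lborel (\<lambda>u. exp (\<i> * of_real (a * u)) * of_real (normal_density m' r u) :: complex)"
    if "0 < r" for a m' r
    by (rule Bochner_Integration.integrable_bound[OF integrable_normal_density[OF that, of m']])
      (auto simp: norm_mult)
  have "(\<integral>u. exp (\<i> * of_real (r * u)) * of_real (std_normal_density u) \<partial>lborel)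
      = (of_real (exp (- (r\<^sup>2) / 2)) :: complex)" for r
    using fun_cong[OF char_std_normal_distribution, of r]
    by (simp add: char_def integral_density scaleR_conv_of_real mult.commute)
  note std = this
  have "(\<integral>u. ?F u \<partial>lborel) = \<sigma> *\<^sub>R (\<integral>u. ?F (m + \<sigma> * u) \<partial>lborel)"
    using \<sigma> by (subst lborel_integral_real_affine[where c = \<sigma> and t = m]) auto
  also have "\<dots> = (\<integral>u. exp (\<i> * of_real (t * m)) * (exp (\<i> * of_real ((\<sigma> * t) * u)) * of_real (std_normal_density u)) \<partial>lborel)"
    using \<sigma>
    by (subst integral_scaleR_right[symmetric], intro Bochner_Integration.integral_cong)
       (auto simp: normal_density_def real_sqrt_mult power_mult_distrib exp_add[symmetric] scaleR_conv_of_real field_simps)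
  also have "\<dots> = exp (\<i> * of_real (t * m)) * of_real (exp (- (\<sigma> * t)\<^sup>2 / 2))"
    by (subst integral_mult_right_zero, subst std) simp
  finally show ?thesis using int[OF \<sigma>] by (simp add: has_bochner_integral_iff)
qed

lemma fourier_gauss:
  fixes x t :: "'a::euclidean_space"
  assumes \<sigma>: "0 < \<sigma>"
  shows "fourier (\<lambda>v. of_real (gauss x \<sigma> v)) t
    = exp (\<i> * of_real (t \<bullet> x)) * of_real (exp (- \<sigma>\<^sup>2 * (norm t)\<^sup>2 / 2))"
proof -
  let ?F = "\<lambda>b u. exp (\<i> * of_real ((t \<bullet> b) * u)) * of_real (normal_density (x \<bullet> b) \<sigma> u) :: complex"
  interpret product_sigma_finite "\<lambda>_::'a. lborel::real measure" by standard
  have [measurable]: "?F b \<in> borel_measurable borel" for b by measurable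
  have [measurable]: "(\<lambda>f. \<Sum>b\<in>Basis. f b *\<^sub>R b) \<in> measurable (Pi\<^sub>M Basis (\<lambda>_. lborel)) (borel :: 'a measure)"
    by (intro borel_measurable_sum borel_measurable_scaleR) auto
  have ti: "exp (\<i> * of_real (t \<bullet> v)) = (\<Prod>b\<in>Basis. exp (\<i> * complex_of_real ((t \<bullet> b) * (v \<bullet> b))))" for v
    unfolding euclidean_inner[of t v] by (simp add: exp_sum sum_distrib_left)
  have "fourier (\<lambda>v. of_real (gauss x \<sigma> v)) t = (\<integral>v. (\<Prod>b\<in>Basis. ?F b (v \<bullet> b)) \<partial>lborel)"
    unfolding fourier_def gauss_def ti by (simp add: prod.distrib)
  also have "\<dots> = (\<integral>f. (\<Prod>b\<in>Basis. ?F b (f b)) \<partial>Pi\<^sub>M Basis (\<lambda>_. lborel))"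
    \<comment> \<open>Lebesgue measure is the image of the coordinate product measure, so the
      integral of a product of one-dimensional factors becomes a product of integrals.\<close>
    by (subst lborel_eq, subst integral_distr) (auto intro!: Bochner_Integration.integral_cong prod.cong)
  also have "\<dots> = (\<Prod>b\<in>Basis. integral\<^sup>L lborel (?F b))"
    using has_bochner_integral_fourier_normal[OF \<sigma>]
    by (intro product_integral_prod) (auto simp: has_bochner_integral_iff)
  also have "\<dots> = (\<Prod>b\<in>Basis. exp (\<i> * of_real ((t \<bullet> b) * (x \<bullet> b))) * of_real (exp (- (\<sigma> * (t \<bullet> b))\<^sup>2 / 2)))"
    using has_bochner_integral_fourier_normal[OF \<sigma>]
    by (intro prod.cong) (auto simp: has_bochner_integral_iff)
  also have "\<dots> = exp (\<i> * of_real (t \<bullet> x)) * of_real (\<Prod>b\<in>Basis. exp (- (\<sigma> * (t \<bullet> b))\<^sup>2 / 2))"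
    unfolding ti by (simp add: prod.distrib)
  also have "(\<Prod>b\<in>Basis. exp (- (\<sigma> * (t \<bullet> b))\<^sup>2 / 2)) = exp (- \<sigma>\<^sup>2 * (norm t)\<^sup>2 / 2)"
    unfolding power2_norm_eq_inner euclidean_inner[of t t]
    by (simp add: exp_sum[symmetric] sum_distrib_left sum_divide_distrib sum_negf power2_eq_square mult_ac)
  finally show ?thesis .
qed

section \<open>Gaussian mixtures in the Sobolev ellipsoid\<close>

text \<open>At \<open>\<epsilon> = 0\<close> this is \<open>gauss x 1\<close>, so both hypotheses of
  the two-point method are instances.\<close>

definition gauss_mixture :: "'a::euclidean_space \<Rightarrow> real \<Rightarrow> real \<Rightarrow> 'a \<Rightarrow> real" where
  "gauss_mixture x \<epsilon> \<sigma> v = (1 - \<epsilon>) * gauss x 1 v + \<epsilon> * gauss x \<sigma> v"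

lemma gauss_mixture_nonneg: "0 \<le> \<epsilon> \<Longrightarrow> \<epsilon> \<le> 1 \<Longrightarrow> 0 \<le> gauss_mixture x \<epsilon> \<sigma> v"
  by (simp add: gauss_mixture_def gauss_nonneg)

lemma continuous_gauss_mixture: "continuous_on UNIV (gauss_mixture x \<epsilon> \<sigma>)"
  unfolding gauss_mixture_def[abs_def] by (intro continuous_intros continuous_gauss)

lemma borel_measurable_gauss_mixture[measurable]: "gauss_mixture x \<epsilon> \<sigma> \<in> borel_measurable borel"
  by (intro borel_measurable_continuous_onI continuous_gauss_mixture)

lemma nn_integral_gauss_mixture:
  assumes "0 \<le> \<epsilon>" "\<epsilon> \<le> 1" "0 < \<sigma>"
  shows "(\<integral>\<^sup>+v. ennreal (gauss_mixture x \<epsilon> \<sigma> v) \<partial>lborel) = 1"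
proof -
  have "(\<integral>\<^sup>+v. ennreal (gauss_mixture x \<epsilon> \<sigma> v) \<partial>lborel)
      = (\<integral>\<^sup>+v. ennreal (1 - \<epsilon>) * ennreal (gauss x 1 v) + ennreal \<epsilon> * ennreal (gauss x \<sigma> v) \<partial>lborel)"
    using assms unfolding gauss_mixture_def
    by (intro nn_integral_cong) (simp add: ennreal_mult gauss_nonneg)
  also have "\<dots> = ennreal (1 - \<epsilon>) + ennreal \<epsilon>"
    using assms by (simp add: nn_integral_add nn_integral_cmult nn_integral_gauss)
  also have "\<dots> = 1" using assms by (simp add: ennreal_plus[symmetric] del: ennreal_plus)
  finally show ?thesis .
qed

lemma integrable_gauss_mixture: "0 < \<sigma> \<Longrightarrow> integrable lborel (gauss_mixture x \<epsilon> \<sigma>)"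
  unfolding gauss_mixture_def[abs_def] by (intro Bochner_Integration.integrable_add integrable_mult_right integrable_gauss) auto

lemma gauss_le_center: "0 < \<sigma> \<Longrightarrow> gauss x \<sigma> v \<le> gauss x \<sigma> x"
  by (simp add: gauss_eq mult_left_le)

text \<open>A density bounded by its value at the centre is square integrable: its square is at most
  \<open>gauss_mixture x \<epsilon> \<sigma> x\<close> times itself.\<close>

lemma gauss_mixture_L2:
  assumes "0 \<le> \<epsilon>" "\<epsilon> \<le> 1" "0 < \<sigma>"
  shows "(\<lambda>v. complex_of_real (gauss_mixture x \<epsilon> \<sigma> v)) \<in> L2_functions"
proof -
  let ?f = "gauss_mixture x \<epsilon> \<sigma>"
  note nn = gauss_mixture_nonneg[OF assms(1,2), of x \<sigma>]
  have "?f v \<le> ?f x" for v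
    unfolding gauss_mixture_def using assms by (intro add_mono mult_left_mono gauss_le_center) auto
  then have "(\<integral>\<^sup>+v. ennreal ((?f v)\<^sup>2) \<partial>lborel) \<le> (\<integral>\<^sup>+v. ennreal (?f x) * ennreal (?f v) \<partial>lborel)"
    using nn by (intro nn_integral_mono) (simp add: ennreal_mult[symmetric] power2_eq_square mult_right_mono)
  also have "\<dots> = ennreal (?f x)"
    by (simp add: nn_integral_cmult nn_integral_gauss_mixture[OF assms])
  also have "\<dots> < \<infinity>" by simp
  finally show ?thesis by (simp add: L2_functions_def)
qed

text \<open>Both components are centred at \<open>x\<close> and share one phase, which drops out of
  the modulus; hence Sobolev bounds do not depend on \<open>x\<close>.\<close>

lemma fourier_gauss_mixture:
  fixes x t :: "'a::euclidean_space"
  assumes \<sigma>: "0 < \<sigma>"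
  shows "fourier (\<lambda>v. of_real (gauss_mixture x \<epsilon> \<sigma> v)) t = exp (\<i> * of_real (t \<bullet> x))
    * of_real ((1 - \<epsilon>) * exp (- (norm t)\<^sup>2 / 2) + \<epsilon> * exp (- \<sigma>\<^sup>2 * (norm t)\<^sup>2 / 2))"
proof -
  have int: "integrable lborel (\<lambda>v. exp (\<i> * of_real (t \<bullet> v)) * complex_of_real (gauss x r v))"
    if "0 < r" for r
    by (rule Bochner_Integration.integrable_bound[OF integrable_gauss[OF that, of x]])
      (auto simp: norm_mult)
  have "fourier (\<lambda>v. of_real (gauss_mixture x \<epsilon> \<sigma> v)) t
      = (\<integral>v. of_real (1 - \<epsilon>) * (exp (\<i> * of_real (t \<bullet> v)) * complex_of_real (gauss x 1 v))
          + of_real \<epsilon> * (exp (\<i> * of_real (t \<bullet> v)) * complex_of_real (gauss x \<sigma> v)) \<partial>lborel)"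
    unfolding fourier_def gauss_mixture_def by (simp add: algebra_simps)
  also have "\<dots> = of_real (1 - \<epsilon>) * fourier (\<lambda>v. of_real (gauss x 1 v)) t
      + of_real \<epsilon> * fourier (\<lambda>v. of_real (gauss x \<sigma> v)) t"
    unfolding fourier_def using int[of 1] int[OF \<sigma>]
    by (subst Bochner_Integration.integral_add) auto
  finally show ?thesis
    by (simp add: fourier_gauss \<sigma> algebra_simps)
qed

section \<open>Sobolev integrals of Gaussian mixtures\<close>

text \<open>Raise \<open>z \<le> exp z\<close> with \<open>z = a * y / \<beta>\<close> to the power
  \<open>\<beta>\<close>. It lets a Gaussian factor absorb the polynomial Sobolev weight.\<close>

lemma powr_le_exp:
  fixes \<beta> a y :: real
  assumes "0 < \<beta>" "0 < a" "0 \<le> y"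
  shows "y powr \<beta> \<le> (\<beta> / a) powr \<beta> * exp (a * y)"
proof -
  have "y powr \<beta> = (\<beta> / a) powr \<beta> * (a * y / \<beta>) powr \<beta>"
    using assms by (simp add: powr_mult[symmetric])
  also have "(a * y / \<beta>) powr \<beta> \<le> exp (a * y / \<beta>) powr \<beta>"
  proof (rule powr_mono2)
    show "a * y / \<beta> \<le> exp (a * y / \<beta>)" using exp_ge_add_one_self[of "a * y / \<beta>"] by linarith
  qed (use assms in auto)
  also have "exp (a * y / \<beta>) powr \<beta> = exp (a * y)"
    using assms by (simp add: exp_powr_real)
  finally show ?thesis by (simp add: mult_left_mono)
qed

text \<open>The first two factors come from \<open>powr_le_exp\<close> with
  \<open>a = \<sigma>\<^sup>2 / 2\<close> and \<sigma> at most 1; the last one normalises a Gaussian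
  in dimension \<open>d\<close>.\<close>

definition sobolev_const :: "real \<Rightarrow> nat \<Rightarrow> real" where
  "sobolev_const \<beta> d = (2 * \<beta>) powr \<beta> * exp (1 / 2) * sqrt (2 * pi) ^ d"

text \<open>Half of the exponent absorbs the weight at the cost of a factor \<sigma>^(-2\<beta>).
  The other half is a multiple of the density of N(0, \<sigma>^(-2) I), whose normalisation
  contributes \<sigma>^(-d).\<close>

lemma gauss_sobolev_integral_le:
  assumes \<beta>: "0 < \<beta>" and \<sigma>: "0 < \<sigma>" "\<sigma> \<le> 1"
  shows "(\<integral>\<^sup>+t. ennreal ((1 + (norm t)\<^sup>2) powr \<beta> * exp (- \<sigma>\<^sup>2 * (norm t)\<^sup>2)) \<partial>(lborel :: 'a::euclidean_space measure))
    \<le> ennreal (sobolev_const \<beta> DIM('a) * \<sigma> powr (- (2 * \<beta> + real DIM('a))))"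
proof -
  let ?K = "sobolev_const \<beta> DIM('a) * \<sigma> powr (- (2 * \<beta> + real DIM('a)))"
  have pw: "(1 + (norm t)\<^sup>2) powr \<beta> * exp (- \<sigma>\<^sup>2 * (norm t)\<^sup>2) \<le> ?K * gauss 0 (1 / \<sigma>) t" for t :: 'a
  proof -
    have "(1 + (norm t)\<^sup>2) powr \<beta> * exp (- \<sigma>\<^sup>2 * (norm t)\<^sup>2)
        \<le> (\<beta> / (\<sigma>\<^sup>2 / 2)) powr \<beta> * exp (\<sigma>\<^sup>2 / 2 * (1 + (norm t)\<^sup>2)) * exp (- \<sigma>\<^sup>2 * (norm t)\<^sup>2)"
      using \<beta> \<sigma> by (intro mult_right_mono powr_le_exp) auto
    also have "\<dots> = (\<beta> / (\<sigma>\<^sup>2 / 2)) powr \<beta> * exp (\<sigma>\<^sup>2 / 2) * exp (- \<sigma>\<^sup>2 * (norm t)\<^sup>2 / 2)"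
      unfolding mult.assoc exp_add[symmetric]
      by (intro arg_cong2[where f = "(*)"] arg_cong[where f = exp] refl) (simp add: field_simps)
    also have "\<dots> \<le> (\<beta> / (\<sigma>\<^sup>2 / 2)) powr \<beta> * exp (1 / 2) * exp (- \<sigma>\<^sup>2 * (norm t)\<^sup>2 / 2)"
      using \<sigma> by (intro mult_right_mono mult_left_mono) (auto simp: power_le_one)
    also have "(\<beta> / (\<sigma>\<^sup>2 / 2)) powr \<beta> = (2 * \<beta>) powr \<beta> * \<sigma> powr (- (2 * \<beta>))"
    proof -
      have "\<beta> / (\<sigma>\<^sup>2 / 2) = (2 * \<beta>) / \<sigma> powr 2" using \<sigma> by (simp add: powr_numeral)
      then have "(\<beta> / (\<sigma>\<^sup>2 / 2)) powr \<beta> = ((2 * \<beta>) / \<sigma> powr 2) powr \<beta>" by (simp only:)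
      also have "\<dots> = (2 * \<beta>) powr \<beta> / (\<sigma> powr 2) powr \<beta>"
        by (rule powr_divide)
      also have "(\<sigma> powr 2) powr \<beta> = \<sigma> powr (2 * \<beta>)" by (rule powr_powr)
      finally show ?thesis by (simp only: powr_minus divide_inverse)
    qed
    also have "exp (- \<sigma>\<^sup>2 * (norm t)\<^sup>2 / 2) = sqrt (2 * pi) ^ DIM('a) * \<sigma> powr (- real DIM('a)) * gauss 0 (1 / \<sigma>) t"
    proof -
      have "1 / sqrt (2 * pi * (1 / \<sigma>)\<^sup>2) = \<sigma> / sqrt (2 * pi)"
        using \<sigma> by (simp add: real_sqrt_mult real_sqrt_divide power_one_over)
      moreover have "- (norm t)\<^sup>2 / (2 * (1 / \<sigma>)\<^sup>2) = - \<sigma>\<^sup>2 * (norm t)\<^sup>2 / 2"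
        by (simp add: power_one_over)
      ultimately have "gauss 0 (1 / \<sigma>) t = (\<sigma> / sqrt (2 * pi)) ^ DIM('a) * exp (- \<sigma>\<^sup>2 * (norm t)\<^sup>2 / 2)"
        using \<sigma> by (simp only: gauss_eq diff_zero zero_less_divide_1_iff)
      then show ?thesis using \<sigma> by (simp add: power_divide powr_minus powr_realpow)
    qed
    finally have "(1 + (norm t)\<^sup>2) powr \<beta> * exp (- \<sigma>\<^sup>2 * (norm t)\<^sup>2)
      \<le> (2 * \<beta>) powr \<beta> * \<sigma> powr (- (2 * \<beta>)) * exp (1 / 2)
        * (sqrt (2 * pi) ^ DIM('a) * \<sigma> powr (- real DIM('a)) * gauss 0 (1 / \<sigma>) t)" .
    also have "\<dots> = ?K * gauss 0 (1 / \<sigma>) t"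
      unfolding sobolev_const_def minus_add_distrib powr_add by (simp only: mult_ac)
    finally show ?thesis .
  qed
  have K: "0 \<le> ?K" by (simp add: sobolev_const_def)
  have "(\<integral>\<^sup>+t. ennreal ((1 + (norm t)\<^sup>2) powr \<beta> * exp (- \<sigma>\<^sup>2 * (norm t)\<^sup>2)) \<partial>(lborel :: 'a measure))
      \<le> (\<integral>\<^sup>+t. ennreal ?K * ennreal (gauss 0 (1 / \<sigma>) t) \<partial>(lborel :: 'a measure))"
    using pw K by (intro nn_integral_mono) (simp add: ennreal_mult[symmetric] gauss_nonneg)
  also have "\<dots> = ennreal ?K" using \<sigma> by (simp add: nn_integral_cmult nn_integral_gauss)
  finally show ?thesis .
qed

text \<open>After \<open>(a + b)\<^sup>2 \<le> 2 * a\<^sup>2 + 2 * b\<^sup>2\<close> each component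
  contributes at most twice \<open>sobolev_const\<close>: the wide one is the case \<sigma> = 1 of
  the previous bound, and for the narrow one the hypothesis on \<open>\<epsilon>\<^sup>2\<close>
  cancels the negative power of \<sigma>.\<close>

lemma gauss_mixture_sobolev_integral_le:
  fixes x :: "'a::euclidean_space"
  assumes \<beta>: "0 < \<beta>" and \<sigma>: "0 < \<sigma>" "\<sigma> \<le> 1" and \<epsilon>: "0 \<le> \<epsilon>" "\<epsilon> \<le> 1"
    and \<epsilon>\<sigma>: "\<epsilon>\<^sup>2 \<le> \<sigma> powr (2 * \<beta> + real DIM('a))"
  shows "(\<integral>\<^sup>+t. ennreal ((1 + (norm t)\<^sup>2) powr \<beta>
      * (cmod (fourier (\<lambda>v. of_real (gauss_mixture x \<epsilon> \<sigma> v)) t))\<^sup>2) \<partial>lborel)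
    \<le> ennreal (4 * sobolev_const \<beta> DIM('a))"
proof -
  let ?M = "sobolev_const \<beta> DIM('a)"
  let ?p = "\<lambda>r (t::'a). (1 + (norm t)\<^sup>2) powr \<beta> * exp (- r\<^sup>2 * (norm t)\<^sup>2)"
  have M: "0 \<le> ?M" by (simp add: sobolev_const_def)
  have pw: "(1 + (norm t)\<^sup>2) powr \<beta> * (cmod (fourier (\<lambda>v. of_real (gauss_mixture x \<epsilon> \<sigma> v)) t))\<^sup>2
      \<le> 2 * ?p 1 t + 2 * \<epsilon>\<^sup>2 * ?p \<sigma> t" for t
  proof -
    let ?a = "exp (- (norm t)\<^sup>2 / 2)" and ?b = "exp (- \<sigma>\<^sup>2 * (norm t)\<^sup>2 / 2)"
    have "cmod (fourier (\<lambda>v. of_real (gauss_mixture x \<epsilon> \<sigma> v)) t) = \<bar>(1 - \<epsilon>) * ?a + \<epsilon> * ?b\<bar>"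
      unfolding fourier_gauss_mixture[OF \<sigma>(1)] norm_mult norm_of_real by simp
    then have "(cmod (fourier (\<lambda>v. of_real (gauss_mixture x \<epsilon> \<sigma> v)) t))\<^sup>2 = ((1 - \<epsilon>) * ?a + \<epsilon> * ?b)\<^sup>2"
      by simp
    also have "\<dots> \<le> 2 * ((1 - \<epsilon>) * ?a)\<^sup>2 + 2 * (\<epsilon> * ?b)\<^sup>2"
      using sum_squares_bound[of "(1 - \<epsilon>) * ?a" "\<epsilon> * ?b"] by (simp add: power2_sum)
    also have "((1 - \<epsilon>) * ?a)\<^sup>2 \<le> ?a\<^sup>2"
      using \<epsilon> by (intro power_mono) (auto simp: mult_left_le_one_le)
    also have "?a\<^sup>2 = exp (- 1\<^sup>2 * (norm t)\<^sup>2)" by (simp add: exp_double[symmetric])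
    also have "(\<epsilon> * ?b)\<^sup>2 = \<epsilon>\<^sup>2 * exp (- \<sigma>\<^sup>2 * (norm t)\<^sup>2)"
      by (simp add: power_mult_distrib exp_double[symmetric])
    finally have "(1 + (norm t)\<^sup>2) powr \<beta> * (cmod (fourier (\<lambda>v. of_real (gauss_mixture x \<epsilon> \<sigma> v)) t))\<^sup>2
      \<le> (1 + (norm t)\<^sup>2) powr \<beta> * (2 * exp (- 1\<^sup>2 * (norm t)\<^sup>2) + 2 * (\<epsilon>\<^sup>2 * exp (- \<sigma>\<^sup>2 * (norm t)\<^sup>2)))"
      by (intro mult_left_mono) auto
    then show ?thesis by (simp add: algebra_simps)
  qed
  have "(\<integral>\<^sup>+t. ennreal ((1 + (norm t)\<^sup>2) powr \<beta>
      * (cmod (fourier (\<lambda>v. of_real (gauss_mixture x \<epsilon> \<sigma> v)) t))\<^sup>2) \<partial>lborel)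
    \<le> (\<integral>\<^sup>+t. ennreal 2 * ennreal (?p 1 t) + ennreal (2 * \<epsilon>\<^sup>2) * ennreal (?p \<sigma> t) \<partial>lborel)"
    by (intro nn_integral_mono order_trans[OF ennreal_leI[OF pw]])
      (simp add: ennreal_mult[symmetric] ennreal_plus[symmetric] del: ennreal_plus flip: ennreal_numeral)
  also have "\<dots> = ennreal 2 * (\<integral>\<^sup>+t. ennreal (?p 1 t) \<partial>lborel) + ennreal (2 * \<epsilon>\<^sup>2) * (\<integral>\<^sup>+t. ennreal (?p \<sigma> t) \<partial>lborel)"
    by (simp add: nn_integral_add nn_integral_cmult)
  also have "\<dots> \<le> ennreal 2 * ennreal (?M * 1 powr (- (2 * \<beta> + real DIM('a))))
      + ennreal (2 * \<epsilon>\<^sup>2) * ennreal (?M * \<sigma> powr (- (2 * \<beta> + real DIM('a))))"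
    using \<beta> \<sigma> by (intro add_mono mult_left_mono gauss_sobolev_integral_le) auto
  also have "\<dots> = ennreal (2 * ?M + 2 * (?M * (\<epsilon>\<^sup>2 * \<sigma> powr (- (2 * \<beta> + real DIM('a))))))"
    using M by (simp add: ennreal_mult[symmetric] ennreal_plus[symmetric] mult_ac del: ennreal_plus flip: ennreal_numeral)
  also have "\<dots> \<le> ennreal (4 * ?M)"
  proof (rule ennreal_leI)
    have "\<epsilon>\<^sup>2 * \<sigma> powr (- (2 * \<beta> + real DIM('a))) \<le> \<sigma> powr (2 * \<beta> + real DIM('a)) * \<sigma> powr (- (2 * \<beta> + real DIM('a)))"
      by (intro mult_right_mono \<epsilon>\<sigma>) simp
    also have "\<dots> = 1" using \<sigma> by (simp add: powr_add[symmetric])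
    finally have "?M * (\<epsilon>\<^sup>2 * \<sigma> powr (- (2 * \<beta> + real DIM('a)))) \<le> ?M * 1"
      by (rule mult_left_mono[OF _ M])
    then show "2 * ?M + 2 * (?M * (\<epsilon>\<^sup>2 * \<sigma> powr (- (2 * \<beta> + real DIM('a))))) \<le> 4 * ?M" by simp
  qed
  finally show ?thesis .
qed

lemma gauss_mixture_in_sobolev_densities:
  fixes x :: "'a::euclidean_space"
  assumes \<beta>: "0 < \<beta>" and \<sigma>: "0 < \<sigma>" "\<sigma> \<le> 1" and \<epsilon>: "0 \<le> \<epsilon>" "\<epsilon> \<le> 1"
    and \<epsilon>\<sigma>: "\<epsilon>\<^sup>2 \<le> \<sigma> powr (2 * \<beta> + real DIM('a))" and L: "4 * sobolev_const \<beta> DIM('a) \<le> L"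
  shows "gauss_mixture x \<epsilon> \<sigma> \<in> sobolev_densities \<beta> L"
proof -
  let ?f = "\<lambda>v. complex_of_real (gauss_mixture x \<epsilon> \<sigma> v)"
  note bound = gauss_mixture_sobolev_integral_le[OF \<beta> \<sigma> \<epsilon> \<epsilon>\<sigma>, of x]
  have "fourier ?f \<in> L2_functions"
  proof -
    have [measurable]: "fourier ?f \<in> borel_measurable borel"
      unfolding fourier_gauss_mixture[OF \<sigma>(1), abs_def] by measurable
    \<comment> \<open>The Sobolev weight is at least 1, so the weighted bound controls the plain
      square integral.\<close>
    have "(\<integral>\<^sup>+t. ennreal ((cmod (fourier ?f t))\<^sup>2) \<partial>lborel)
        \<le> (\<integral>\<^sup>+t. ennreal ((1 + (norm t)\<^sup>2) powr \<beta> * (cmod (fourier ?f t))\<^sup>2) \<partial>lborel)"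
    proof (intro nn_integral_mono ennreal_leI)
      fix t :: 'a
      have "1 \<le> (1 + (norm t)\<^sup>2) powr \<beta>" using \<beta> by (intro ge_one_powr_ge_zero) auto
      then show "(cmod (fourier ?f t))\<^sup>2 \<le> (1 + (norm t)\<^sup>2) powr \<beta> * (cmod (fourier ?f t))\<^sup>2"
        using mult_right_mono[of 1 _ "(cmod (fourier ?f t))\<^sup>2"] by simp
    qed
    also have "\<dots> < \<infinity>" using order.strict_trans1[OF bound] by simp
    finally show ?thesis by (simp add: L2_functions_def)
  qed
  then have "is_fourier_L2 ?f (fourier ?f)"
    unfolding is_fourier_L2_def using gauss_mixture_L2[OF \<epsilon> \<sigma>(1), of x] integrable_gauss_mixture[OF \<sigma>(1), of x \<epsilon>]
    \<comment> \<open>The mixture is itself in L1 and L2, so the constant sequence serves as the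
      approximating sequence.\<close>
    by (auto intro!: exI[of _ "\<lambda>_. ?f"])
  then have "gauss_mixture x \<epsilon> \<sigma> \<in> sobolev_ellipsoid \<beta> L"
    unfolding sobolev_ellipsoid_def using order_trans[OF bound ennreal_leI[OF L]] by blast
  then show ?thesis
    using \<epsilon> \<sigma> by (simp add: sobolev_densities_def prob_densities_def continuous_gauss_mixture
        gauss_mixture_nonneg nn_integral_gauss_mixture)
qed

section \<open>The law of the observations and the lower bound\<close>

definition normal_mixture :: "real \<Rightarrow> real \<Rightarrow> real \<Rightarrow> real \<Rightarrow> real" where
  "normal_mixture m \<epsilon> \<sigma> u = (1 - \<epsilon>) * normal_density m 1 u + \<epsilon> * normal_density m \<sigma> u"

lemma radon_gauss_mixture:
  assumes "norm s = 1" "0 < \<sigma>"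
  shows "radon (gauss_mixture x \<epsilon> \<sigma>) s u = normal_mixture (x \<bullet> s) \<epsilon> \<sigma> u"
  using has_bochner_integral_hyperplane_gauss[OF assms, of u x]
    has_bochner_integral_hyperplane_gauss[OF assms(1), of 1 u x]
  by (simp add: radon_def gauss_mixture_def[abs_def] normal_mixture_def has_bochner_integral_iff)

text \<open>The narrower density has the smaller exponential factor, so only the normalising
  constants differ, by \<open>1 / \<sigma>\<close>. It bounds the likelihood ratio of one
  observation. The loss is one power of \<sigma> rather than \<open>d\<close> because projections
  are one-dimensional; this produces the exponent 2\<beta> + d - 1.\<close>

lemma normal_density_le_unit:
  "0 < \<sigma> \<Longrightarrow> \<sigma> \<le> 1 \<Longrightarrow> normal_density m \<sigma> u \<le> normal_density m 1 u / \<sigma>"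
proof -
  assume \<sigma>: "0 < \<sigma>" "\<sigma> \<le> 1"
  have "(u - m)\<^sup>2 * \<sigma>\<^sup>2 \<le> (u - m)\<^sup>2" using \<sigma> by (intro mult_right_le_one_le) (auto simp: power_le_one)
  then have "- (u - m)\<^sup>2 / (2 * \<sigma>\<^sup>2) \<le> - (u - m)\<^sup>2 / 2" using \<sigma> by (simp add: field_simps)
  then show ?thesis using \<sigma> by (simp add: normal_density_def real_sqrt_mult field_simps)
qed

lemma sphere_area_pos: "0 < d \<Longrightarrow> 0 < sphere_area d"
  by (simp add: sphere_area_def Gamma_real_pos)

section \<open>Integration over the observation space\<close>

lemma sets_sphere_measure: "sets (sphere_measure :: 'a::euclidean_space measure) = sets (restrict_space borel (sphere 0 1))"
  by (simp add: sphere_measure_def)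

text \<open>When the integral over \<open>u\<close> is the same for every direction, only the total
  mass of the sphere enters.\<close>

lemma nn_integral_obs_measure:
  fixes F :: "'a::euclidean_space \<times> real \<Rightarrow> ennreal"
  assumes [measurable]: "F \<in> borel_measurable obs_measure"
    and k: "\<And>s. norm s = 1 \<Longrightarrow> (\<integral>\<^sup>+u. F (s, u) \<partial>lborel) = k"
  shows "(\<integral>\<^sup>+\<omega>. F \<omega> \<partial>obs_measure) = k * ennreal (sphere_area DIM('a))"
proof -
  have "(\<integral>\<^sup>+\<omega>. F \<omega> \<partial>obs_measure) = (\<integral>\<^sup>+s. (\<integral>\<^sup>+u. F (s, u) \<partial>lborel) \<partial>sphere_measure)"
    using assms(1) unfolding obs_measure_def by (rule lborel.nn_integral_fst[symmetric])
  also have "\<dots> = (\<integral>\<^sup>+s. k \<partial>(sphere_measure :: 'a measure))"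
    by (intro nn_integral_cong k) (simp add: space_sphere_measure)
  finally show ?thesis using sphere_measure_total[where 'a = 'a] by (simp add: space_sphere_measure)
qed

lemma borel_measurable_obs_normal[measurable]:
  "(\<lambda>\<omega>. normal_density (x \<bullet> fst \<omega>) \<sigma> (snd \<omega>)) \<in> borel_measurable (obs_measure :: ('a::euclidean_space \<times> real) measure)"
proof -
  have "(\<lambda>s. x \<bullet> s) \<in> borel_measurable (sphere_measure :: 'a measure)"
    by (subst measurable_cong_sets[OF sets_sphere_measure refl]) (intro measurable_restrict_space1, measurable)
  then have [measurable]: "(\<lambda>\<omega>. x \<bullet> fst \<omega>) \<in> borel_measurable (obs_measure :: ('a \<times> real) measure)"
    unfolding obs_measure_def by (intro measurable_compose[OF measurable_fst])
  have [measurable]: "snd \<in> borel_measurable (obs_measure :: ('a \<times> real) measure)"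
    unfolding obs_measure_def by (rule measurable_compose[OF measurable_snd]) simp
  show ?thesis unfolding normal_density_def by measurable
qed

text \<open>The closed form of the density of one observation, written for all pairs so that its
  measurability is immediate; it is tied to \<open>radon\<close> at unit directions only.\<close>

definition obs_density :: "'a::euclidean_space \<Rightarrow> real \<Rightarrow> real \<Rightarrow> 'a \<times> real \<Rightarrow> real" where
  "obs_density x \<epsilon> \<sigma> \<omega> = normal_mixture (x \<bullet> fst \<omega>) \<epsilon> \<sigma> (snd \<omega>) / sphere_area DIM('a)"

lemma borel_measurable_obs_density[measurable]: "obs_density x \<epsilon> \<sigma> \<in> borel_measurable obs_measure"
  unfolding obs_density_def[abs_def] normal_mixture_def by measurable

lemma obs_density_nonneg: "0 \<le> \<epsilon> \<Longrightarrow> \<epsilon> \<le> 1 \<Longrightarrow> 0 \<le> obs_density (x::'a::euclidean_space) \<epsilon> \<sigma> \<omega>"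
  using sphere_area_pos[of "DIM('a)"] by (simp add: obs_density_def normal_mixture_def)

text \<open>On the space of \<open>obs_measure\<close> all directions are unit vectors, so the two
  densities agree there, and the Radon transform inherits measurability from the closed
  form.\<close>

lemma radon_law_gauss_mixture:
  fixes x :: "'a::euclidean_space"
  assumes "0 < \<sigma>"
  shows "radon_law (gauss_mixture x \<epsilon> \<sigma>) = density obs_measure (\<lambda>\<omega>. ennreal (obs_density x \<epsilon> \<sigma> \<omega>))"
proof -
  let ?f = "\<lambda>\<omega>. case \<omega> of (s, u) \<Rightarrow> ennreal (radon (gauss_mixture x \<epsilon> \<sigma>) s u / sphere_area DIM('a))"
  have eq: "?f \<omega> = ennreal (obs_density x \<epsilon> \<sigma> \<omega>)" if "\<omega> \<in> space (obs_measure :: ('a \<times> real) measure)" for \<omega>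
    using that
    by (auto simp: obs_measure_def space_pair_measure space_sphere_measure obs_density_def
        radon_gauss_mixture[OF _ assms])
  then have "?f \<in> borel_measurable obs_measure"
    by (subst measurable_cong[OF eq]) auto
  then show ?thesis unfolding radon_law_def
    by (intro density_cong) (auto simp: eq)
qed

text \<open>The weights need not sum to 1: the chi-square bound applies it to weights of a
  majorant.\<close>

lemma nn_integral_obs_density:
  fixes x :: "'a::euclidean_space"
  assumes "0 \<le> a" "0 \<le> b" "0 < \<sigma>"
  shows "(\<integral>\<^sup>+\<omega>. ennreal ((a * normal_density (x \<bullet> fst \<omega>) 1 (snd \<omega>) + b * normal_density (x \<bullet> fst \<omega>) \<sigma> (snd \<omega>))
      / sphere_area DIM('a)) \<partial>obs_measure) = ennreal (a + b)"
proof -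
  have A: "0 < sphere_area DIM('a)" by (intro sphere_area_pos) simp
  have "(\<integral>\<^sup>+u. ennreal ((a * normal_density m 1 u + b * normal_density m \<sigma> u) / sphere_area DIM('a)) \<partial>lborel)
      = ennreal ((a + b) / sphere_area DIM('a))" for m
    using assms A
    by (subst nn_integral_eq_integral) auto
  then show ?thesis
    using A assms by (subst nn_integral_obs_measure) (auto simp: ennreal_mult[symmetric])
qed

lemma prob_space_obs_density:
  assumes "0 \<le> \<epsilon>" "\<epsilon> \<le> 1" "0 < \<sigma>"
  shows "prob_space (density obs_measure (\<lambda>\<omega>. ennreal (obs_density x \<epsilon> \<sigma> \<omega>)))"
  using nn_integral_obs_density[of "1 - \<epsilon>" \<epsilon> \<sigma> x] assms
  by (intro prob_spaceI) (simp add: emeasure_density obs_density_def normal_mixture_def cong: nn_integral_cong)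

section \<open>Indistinguishability of the two hypotheses\<close>

text \<open>For one observation the second moment of the likelihood ratio is at most 1 -
  \<epsilon>^2 + \<epsilon>^2/\<sigma>, which \<open>chi\<close> keeps below 1 + 1/n, as the bound
  for product measures requires.\<close>

lemma gauss_mixture_two_point_bound:
  fixes x :: "'a::euclidean_space"
  assumes \<sigma>: "0 < \<sigma>" "\<sigma> \<le> 1" and \<epsilon>: "0 \<le> \<epsilon>" "\<epsilon> \<le> 1"
    and n: "n \<ge> 1" and chi: "\<epsilon>\<^sup>2 / \<sigma> \<le> 1 / real n"
    and est: "est \<in> estimators n"
    and R1: "(\<integral>\<^sup>+\<omega>. ennreal (\<bar>est \<omega> - gauss_mixture x \<epsilon> \<sigma> x\<bar>\<^sup>2) \<partial>sample_law n (gauss_mixture x \<epsilon> \<sigma>)) \<le> R"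
    and R0: "(\<integral>\<^sup>+\<omega>. ennreal (\<bar>est \<omega> - gauss_mixture x 0 \<sigma> x\<bar>\<^sup>2) \<partial>sample_law n (gauss_mixture x 0 \<sigma>)) \<le> R"
  shows "ennreal ((gauss_mixture x \<epsilon> \<sigma> x - gauss_mixture x 0 \<sigma> x)\<^sup>2 / 8) \<le> R"
proof -
  let ?A = "sphere_area DIM('a)"
  define n1 n\<sigma> where "n1 \<omega> = normal_density (x \<bullet> fst \<omega>) 1 (snd \<omega>)"
    and "n\<sigma> \<omega> = normal_density (x \<bullet> fst \<omega>) \<sigma> (snd \<omega>)" for \<omega> :: "'a \<times> real"
  \<comment> \<open>The likelihood ratio of one observation; the factor \<open>1 / ?A\<close> of
    both densities cancels.\<close>
  define w where "w \<omega> = (1 - \<epsilon>) + \<epsilon> * (n\<sigma> \<omega> / n1 \<omega>)" for \<omega>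
  have [measurable]: "n1 \<in> borel_measurable obs_measure" "n\<sigma> \<in> borel_measurable obs_measure"
    unfolding n1_def[abs_def] n\<sigma>_def[abs_def] by measurable
  then have w_meas[measurable]: "w \<in> borel_measurable obs_measure"
    unfolding w_def[abs_def] by measurable
  have A: "0 < ?A" by (intro sphere_area_pos) simp
  have pos: "0 < n1 \<omega>" "0 \<le> n\<sigma> \<omega>" for \<omega>
    by (auto simp: n1_def n\<sigma>_def normal_density_pos)
  have w0: "0 \<le> w \<omega>" for \<omega>
    unfolding w_def using \<epsilon> pos[of \<omega>] by (intro add_nonneg_nonneg mult_nonneg_nonneg divide_nonneg_pos) auto
  have d0: "obs_density x 0 \<sigma> \<omega> = n1 \<omega> / ?A" for \<omega>
    by (simp add: obs_density_def normal_mixture_def n1_def)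
  have d1: "obs_density x 0 \<sigma> \<omega> * w \<omega> = obs_density x \<epsilon> \<sigma> \<omega>" for \<omega>
  proof -
    have "n1 \<omega> * w \<omega> = (1 - \<epsilon>) * n1 \<omega> + \<epsilon> * n\<sigma> \<omega>"
      using pos(1)[of \<omega>] by (simp add: w_def field_simps)
    then show ?thesis unfolding d0 times_divide_eq_left
      by (simp add: obs_density_def normal_mixture_def n1_def n\<sigma>_def)
  qed
  \<comment> \<open>Bounding one factor \<open>n\<sigma> \<omega> / n1 \<omega>\<close> of the
    quadratic term by \<open>1 / \<sigma>\<close> makes the majorant linear in the two densities, so
    its integral is explicit.\<close>
  have d2: "obs_density x 0 \<sigma> \<omega> * (w \<omega>)\<^sup>2 \<le> ((1 - \<epsilon>)\<^sup>2 * n1 \<omega> + (2 * \<epsilon> * (1 - \<epsilon>) + \<epsilon>\<^sup>2 / \<sigma>) * n\<sigma> \<omega>) / ?A" for \<omega>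
  proof -
    have "n\<sigma> \<omega> / n1 \<omega> \<le> 1 / \<sigma>"
      using normal_density_le_unit[OF \<sigma>, of "x \<bullet> fst \<omega>" "snd \<omega>"] pos(1)[of \<omega>] \<sigma>
      by (simp add: n1_def n\<sigma>_def field_simps)
    then have "\<epsilon>\<^sup>2 * n\<sigma> \<omega> * (n\<sigma> \<omega> / n1 \<omega>) \<le> \<epsilon>\<^sup>2 * n\<sigma> \<omega> * (1 / \<sigma>)"
      by (intro mult_left_mono) (auto simp: pos)
    moreover have "n1 \<omega> * (w \<omega>)\<^sup>2
        = (1 - \<epsilon>)\<^sup>2 * n1 \<omega> + 2 * \<epsilon> * (1 - \<epsilon>) * n\<sigma> \<omega> + \<epsilon>\<^sup>2 * n\<sigma> \<omega> * (n\<sigma> \<omega> / n1 \<omega>)"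
      using pos(1)[of \<omega>] by (simp add: w_def power2_eq_square field_simps)
    ultimately have "n1 \<omega> * (w \<omega>)\<^sup>2 \<le> (1 - \<epsilon>)\<^sup>2 * n1 \<omega> + (2 * \<epsilon> * (1 - \<epsilon>) + \<epsilon>\<^sup>2 / \<sigma>) * n\<sigma> \<omega>"
      by (simp add: distrib_right)
    then have "n1 \<omega> * (w \<omega>)\<^sup>2 / ?A \<le> ((1 - \<epsilon>)\<^sup>2 * n1 \<omega> + (2 * \<epsilon> * (1 - \<epsilon>) + \<epsilon>\<^sup>2 / \<sigma>) * n\<sigma> \<omega>) / ?A"
      using A by (intro divide_right_mono) auto
    then show ?thesis by (simp add: d0)
  qed
  let ?M = "radon_law (gauss_mixture x 0 \<sigma>)"
  have law0: "?M = density obs_measure (\<lambda>\<omega>. ennreal (obs_density x 0 \<sigma> \<omega>))"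
    by (rule radon_law_gauss_mixture[OF \<sigma>(1)])
  have law1: "density ?M w = radon_law (gauss_mixture x \<epsilon> \<sigma>)"
    unfolding law0 radon_law_gauss_mixture[OF \<sigma>(1), of x \<epsilon>]
    by (subst density_density_eq)
      (auto simp: ennreal_mult[symmetric] w0 obs_density_nonneg d1)
  have int: "(\<integral>\<^sup>+\<omega>. ennreal (g \<omega>) \<partial>?M) = (\<integral>\<^sup>+\<omega>. ennreal (obs_density x 0 \<sigma> \<omega> * g \<omega>) \<partial>obs_measure)"
    if [measurable]: "g \<in> borel_measurable obs_measure" and "\<And>\<omega>. 0 \<le> g \<omega>" for g
    unfolding law0 using that(2)
    by (subst nn_integral_density) (auto simp: ennreal_mult obs_density_nonneg)
  show ?thesis
  proof (rule product_two_point_bound[OF _ _ _ _ _ n])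
    show "prob_space ?M" unfolding law0 by (rule prob_space_obs_density) (use \<sigma> in auto)
    show "w \<in> borel_measurable ?M" unfolding law0 by simp
    show "0 \<le> w \<omega>" for \<omega> by (rule w0)
    show "(\<integral>\<^sup>+\<omega>. ennreal (w \<omega>) \<partial>?M) = 1"
      using nn_integral_obs_density[of "1 - \<epsilon>" \<epsilon> \<sigma> x] \<epsilon> \<sigma>
      unfolding int[OF w_meas w0] d1 unfolding obs_density_def normal_mixture_def by simp
    have "(\<integral>\<^sup>+\<omega>. ennreal ((w \<omega>)\<^sup>2) \<partial>?M)
        \<le> (\<integral>\<^sup>+\<omega>. ennreal (((1 - \<epsilon>)\<^sup>2 * n1 \<omega> + (2 * \<epsilon> * (1 - \<epsilon>) + \<epsilon>\<^sup>2 / \<sigma>) * n\<sigma> \<omega>) / ?A) \<partial>obs_measure)"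
      by (subst int) (auto intro!: nn_integral_mono ennreal_leI d2)
    also have "\<dots> = ennreal ((1 - \<epsilon>)\<^sup>2 + (2 * \<epsilon> * (1 - \<epsilon>) + \<epsilon>\<^sup>2 / \<sigma>))"
      unfolding n1_def n\<sigma>_def by (rule nn_integral_obs_density) (use \<epsilon> \<sigma> in auto)
    also have "\<dots> \<le> ennreal (1 + 1 / real n)"
    proof (rule ennreal_leI)
      have "(1 - \<epsilon>)\<^sup>2 + 2 * \<epsilon> * (1 - \<epsilon>) = 1 - \<epsilon>\<^sup>2" by (simp add: power2_eq_square algebra_simps)
      moreover have "0 \<le> \<epsilon>\<^sup>2" by simp
      ultimately show "(1 - \<epsilon>)\<^sup>2 + (2 * \<epsilon> * (1 - \<epsilon>) + \<epsilon>\<^sup>2 / \<sigma>) \<le> 1 + 1 / real n"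
        using chi by linarith
    qed
    finally show "(\<integral>\<^sup>+\<omega>. ennreal ((w \<omega>)\<^sup>2) \<partial>?M) \<le> ennreal (1 + 1 / real n)" .
    have "sets (PiM {..<n} (\<lambda>_. ?M)) = sets (PiM {..<n} (\<lambda>_. obs_measure))"
      by (intro sets_PiM_cong) (simp_all add: law0)
    then show "est \<in> borel_measurable (PiM {..<n} (\<lambda>_. ?M))"
      using est measurable_cong_sets unfolding estimators_def by blast
    show "(\<integral>\<^sup>+\<omega>. ennreal (\<bar>est \<omega> - gauss_mixture x \<epsilon> \<sigma> x\<bar>\<^sup>2) \<partial>PiM {..<n} (\<lambda>_. density ?M w)) \<le> R"
      using R1 unfolding law1 sample_law_def .
    show "(\<integral>\<^sup>+\<omega>. ennreal (\<bar>est \<omega> - gauss_mixture x 0 \<sigma> x\<bar>\<^sup>2) \<partial>PiM {..<n} (\<lambda>_. ?M)) \<le> R"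
      using R0 unfolding sample_law_def .
  qed
qed

section \<open>Separation at the point and choice of the parameters\<close>

text \<open>The peak of a Gaussian scales like \<sigma>^(-d). As \<sigma> is at most 1/2, the peak
  of the wide component is at most half that of the narrow one; this half, squared, gives the 4 in
  the denominator.\<close>

lemma gauss_mixture_separation:
  fixes x :: "'a::euclidean_space"
  assumes \<sigma>: "0 < \<sigma>" "\<sigma> \<le> 1 / 2" and \<epsilon>: "0 \<le> \<epsilon>"
  shows "(\<epsilon> / \<sigma> ^ DIM('a))\<^sup>2 / (4 * (2 * pi) ^ DIM('a)) \<le> (gauss_mixture x \<epsilon> \<sigma> x - gauss_mixture x 0 \<sigma> x)\<^sup>2"
proof -
  let ?d = "DIM('a)"
  let ?c = "(1 / sqrt (2 * pi)) ^ ?d"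
  have g: "gauss x r x = ?c / r ^ ?d" if "0 < r" for r
    using that by (simp add: gauss_eq real_sqrt_mult power_divide power_mult_distrib)
  have diff: "gauss_mixture x \<epsilon> \<sigma> x - gauss_mixture x 0 \<sigma> x = \<epsilon> * ?c * (1 / \<sigma> ^ ?d - 1)"
    using g[of 1] g[OF \<sigma>(1)] by (simp add: gauss_mixture_def algebra_simps)
  have "\<sigma> ^ ?d \<le> (1 / 2) ^ ?d" using \<sigma> by (intro power_mono) auto
  also have "\<dots> \<le> (1 / 2) ^ 1" by (intro power_decreasing) (auto simp: Suc_le_eq)
  finally have "1 \<le> 1 / \<sigma> ^ ?d / 2" using \<sigma> by (simp add: field_simps)
  then have "1 / \<sigma> ^ ?d / 2 \<le> 1 / \<sigma> ^ ?d - 1" by simp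
  then have "\<epsilon> * ?c * (1 / \<sigma> ^ ?d / 2) \<le> \<epsilon> * ?c * (1 / \<sigma> ^ ?d - 1)"
    using \<epsilon> by (intro mult_left_mono) auto
  then have "(\<epsilon> * ?c * (1 / \<sigma> ^ ?d / 2))\<^sup>2 \<le> (\<epsilon> * ?c * (1 / \<sigma> ^ ?d - 1))\<^sup>2"
    using \<epsilon> \<sigma> by (intro power_mono) auto
  also have "(\<epsilon> * ?c * (1 / \<sigma> ^ ?d / 2))\<^sup>2 = (\<epsilon> / \<sigma> ^ ?d)\<^sup>2 / (4 * (2 * pi) ^ ?d)"
    by (simp add: power_mult_distrib power_divide power_mult[symmetric] mult.commute[of _ 2])
      (simp add: power_mult)
  finally show ?thesis unfolding diff .
qed

lemma sobolev_risk_lower_bound: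
  fixes x :: "'a::euclidean_space"
  assumes \<beta>: "0 < \<beta>" and L: "4 * sobolev_const \<beta> DIM('a) \<le> L" and n: "n \<ge> 1" and est: "est \<in> estimators n"
  defines "d \<equiv> real DIM('a)"
  shows "ennreal ((1 / 2) powr (2 * \<beta> - d) / (32 * (2 * pi) ^ DIM('a))
      * real n powr (- ((2 * \<beta> - d) / (2 * \<beta> + d - 1))))
    \<le> (SUP f \<in> sobolev_densities \<beta> L. \<integral>\<^sup>+\<omega>. ennreal (\<bar>est \<omega> - f x\<bar>\<^sup>2) \<partial>sample_law n f)"
    (is "ennreal ?b \<le> ?R")
proof -
  have d: "1 \<le> d" unfolding d_def by (simp add: Suc_le_eq)
  define \<gamma> where "\<gamma> = 2 * \<beta> + d - 1"
  have \<gamma>: "0 < \<gamma>" using \<beta> d by (simp add: \<gamma>_def)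
  \<comment> \<open>The power of \<open>n\<close> is forced by \<epsilon>^2/\<sigma> =
    \<sigma>^\<gamma>, which must not exceed 1/n. Halving gives the room that the separation
    needs.\<close>
  define \<sigma> where "\<sigma> = real n powr (- (1 / \<gamma>)) / 2"
  \<comment> \<open>The largest weight that the Sobolev bound admits.\<close>
  define \<epsilon> where "\<epsilon> = \<sigma> powr (\<beta> + d / 2)"
  have "real n powr (- (1 / \<gamma>)) \<le> real n powr 0"
    using n \<gamma> by (intro powr_mono) auto
  then have \<sigma>: "0 < \<sigma>" "\<sigma> \<le> 1 / 2" using n by (auto simp: \<sigma>_def)
  \<comment> \<open>Used with \<open>p = \<gamma>\<close> for the divergence and with
    \<open>p = 2 * \<beta> - d\<close> for the rate.\<close>
  have \<sigma>_powr: "\<sigma> powr p = (1 / 2) powr p * real n powr (- (p / \<gamma>))" for p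
  proof -
    have "\<sigma> = (1 / 2) * real n powr (- (1 / \<gamma>))" by (simp add: \<sigma>_def)
    then have "\<sigma> powr p = (1 / 2) powr p * (real n powr (- (1 / \<gamma>))) powr p"
      by (simp only: powr_mult)
    then show ?thesis by (simp add: powr_powr)
  qed
  have \<epsilon>0: "0 \<le> \<epsilon>" by (simp add: \<epsilon>_def)
  have \<epsilon>1: "\<epsilon> \<le> 1" using \<sigma> \<beta> d by (simp add: \<epsilon>_def powr_le1)
  have \<epsilon>2: "\<epsilon>\<^sup>2 = \<sigma> powr (2 * \<beta> + d)"
    by (simp add: \<epsilon>_def power2_eq_square powr_add[symmetric])
  have "\<epsilon>\<^sup>2 / \<sigma> = \<sigma> powr \<gamma>"
    using \<sigma> by (simp add: \<epsilon>2 \<gamma>_def powr_diff)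
  also have "\<dots> \<le> 1 / real n"
  proof -
    have "(1 / 2) powr \<gamma> \<le> (1::real)" using \<gamma> by (intro powr_le1) auto
    then have "(1 / 2) powr \<gamma> * real n powr - 1 \<le> 1 * real n powr - 1"
      by (rule mult_right_mono) simp
    then show ?thesis using \<gamma> n unfolding \<sigma>_powr[of \<gamma>] by (simp add: powr_minus_divide)
  qed
  finally have chi: "\<epsilon>\<^sup>2 / \<sigma> \<le> 1 / real n" .
  have mem: "gauss_mixture x e \<sigma> \<in> sobolev_densities \<beta> L" if "e = \<epsilon> \<or> e = 0" for e
    using that \<sigma> \<epsilon>0 \<epsilon>1 \<epsilon>2
    by (intro gauss_mixture_in_sobolev_densities[OF \<beta>] L) (auto simp: d_def)
  have "ennreal ((gauss_mixture x \<epsilon> \<sigma> x - gauss_mixture x 0 \<sigma> x)\<^sup>2 / 8) \<le> ?R"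
    using \<sigma> by (intro gauss_mixture_two_point_bound[OF _ _ \<epsilon>0 \<epsilon>1 n chi est] SUP_upper mem) auto
  \<comment> \<open>The squared distance has order (\<epsilon>/\<sigma>^d)^2 =
    \<sigma>^(2\<beta>-d), which is the claimed rate. The 32 in \<open>?b\<close> is 4 from the
    separation times 8 from the two-point bound.\<close>
  moreover have "?b \<le> (gauss_mixture x \<epsilon> \<sigma> x - gauss_mixture x 0 \<sigma> x)\<^sup>2 / 8"
  proof -
    have "(\<epsilon> / \<sigma> ^ DIM('a))\<^sup>2 = \<sigma> powr (2 * \<beta> + d) / \<sigma> powr (2 * d)"
    proof -
      have "\<sigma> ^ DIM('a) = \<sigma> powr d" using \<sigma> by (simp add: d_def powr_realpow)
      moreover have "(\<sigma> powr d)\<^sup>2 = \<sigma> powr (2 * d)" by (simp add: power2_eq_square powr_add[symmetric])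
      ultimately show ?thesis by (simp add: power_divide \<epsilon>2)
    qed
    also have "\<dots> = \<sigma> powr (2 * \<beta> - d)" by (simp add: powr_diff[symmetric])
    finally have "\<sigma> powr (2 * \<beta> - d) / (4 * (2 * pi) ^ DIM('a)) \<le> (gauss_mixture x \<epsilon> \<sigma> x - gauss_mixture x 0 \<sigma> x)\<^sup>2"
      using gauss_mixture_separation[OF \<sigma> \<epsilon>0, of x] by simp
    then have "\<sigma> powr (2 * \<beta> - d) / (4 * (2 * pi) ^ DIM('a)) / 8 \<le> (gauss_mixture x \<epsilon> \<sigma> x - gauss_mixture x 0 \<sigma> x)\<^sup>2 / 8"
      by (rule divide_right_mono) simp
    then show ?thesis unfolding \<sigma>_powr \<gamma>_def by simp
  qed
  ultimately show ?thesis using order_trans ennreal_leI by blast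
qed

theorem theorem2p2:
  fixes \<beta> :: real
  assumes "CARD('n::finite) \<ge> 2" and "\<beta> > 0"
  shows "\<exists>L0::real. L0 > 0 \<and> (\<forall>L\<ge>L0. \<exists>c::real. c > 0 \<and>
    (\<forall>x :: real ^ 'n. \<forall>n::nat. n \<ge> 1 \<longrightarrow> (\<forall>est \<in> estimators n.
      (SUP f \<in> sobolev_densities \<beta> L.
         \<integral>\<^sup>+\<omega>. ennreal (\<bar>est \<omega> - f x\<bar>\<^sup>2) \<partial>sample_law n f)
      \<ge> ennreal (c * real n powr (- ((2 * \<beta> - real CARD('n)) / (2 * \<beta> + real CARD('n) - 1)))))))"
proof -
  let ?d = "CARD('n)"
  \<comment> \<open>One constant serves every \<open>L\<close> above the threshold and every
    \<open>x\<close>: the parameters of the two hypotheses depend on neither, and \<open>x\<close>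
    only translates them.\<close>
  let ?c = "(1 / 2) powr (2 * \<beta> - real ?d) / (32 * (2 * pi) ^ ?d)"
  have "0 < 4 * sobolev_const \<beta> ?d" using assms(2) by (simp add: sobolev_const_def)
  moreover have "0 < ?c" by simp
  moreover have "ennreal (?c * real n powr (- ((2 * \<beta> - real ?d) / (2 * \<beta> + real ?d - 1))))
      \<le> (SUP f \<in> sobolev_densities \<beta> L. \<integral>\<^sup>+\<omega>. ennreal (\<bar>est \<omega> - f x\<bar>\<^sup>2) \<partial>sample_law n f)"
    if "4 * sobolev_const \<beta> ?d \<le> L" "n \<ge> 1" "est \<in> estimators n" for L n est and x :: "real ^ 'n"
    using sobolev_risk_lower_bound[OF assms(2) _ that(2,3), of L x] that(1) by simp
  ultimately show ?thesis by blast
qed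

end
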